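(* Let $G$ be a finite connected graph with vertex set $E$. The $\mathcal{B}(G)$-nested fan $\mathcal{F}(\mathcal{B}(G))$ is the normal fan of the removahedron $\mathrm{Remo}(\mathcal{B}(G))$ if and only if $G$ is chordful.
   Context: A graph is chordful if every cycle of it induces a clique. The graphical building set $\mathcal{B}(G)$ is the collection of all non-empty subsets of $E$ inducing connected subgraphs of $G$. For $R\subseteq E$ put $\mathbb{1}_R=\sum_{r\in R}e_r\in\mathbb{R}^E$. A $\mathcal{B}$-nested set, for a building set $\mathcal{B}$ on $E$ with $E\in\mathcal{B}$, is a subset $\mathcal{N}\subseteq\mathcal{B}\setminus\{E\}$ such that (N1) any two elements of $\mathcal{N}$ are nested or disjoint, and (N2) for any $k\ge2$ pairwise disjoint $N_1,\dots,N_k\in\mathcal{N}$, $N_1\cup\dots\cup N_k\notin\mathcal{B}$. Let $V=\{x\in\mathbb{R}^E:\sum_s x_s=0\}$ and $\bar{\mathbb{1}}_R$ the orthogonal projection of $\mathbb{1}_R$ onto $V$. The $\mathcal{B}$-nested fan $\mathcal{F}(\mathcal{B})$ is the collection of cones $\mathrm{cone}\{\bar{\mathbb{1}}_N:N\in\mathcal{N}\}$ over all $\mathcal{B}$-nested sets $\mathcal{N}$. The removahedron is $\mathrm{Remo}(\mathcal{B})=\{x\in\mathbb{R}^E:\sum_{s\in E}x_s=\binom{|E|+1}{2},\ \sum_{s\in B}x_s\ge\binom{|B|+1}{2}\ \forall B\in\mathcal{B}\}$. For a polytope $P$ in a translate of $V$, the normal cone of a non-empty face $F$ is $\{c\in V:\langle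 c,x\rangle\le\langle c,y\rangle\ \forall x\in F,y\in P\}$; the normal fan is the collection of these cones. *)

theory Defs
  imports "HOL-Analysis.Analysis" "Graph_Theory.Graph_Theory"
begin

text \<open>
  A finite simple graph is a digraph satisfying the locale predicate \<^const>\<open>graph\<close>: finite, loopless,
  without parallel arcs, and symmetric. Its vertex set is the universe of a finite type \<open>'v\<close>,
  so that the ambient Euclidean space is \<open>real ^ 'v\<close>. Both \<open>HOL-Analysis\<close> and \<open>Graph_Theory\<close> use the
  name \<open>connected\<close>, hence the qualified name below.
\<close>

section \<open>Graphs\<close>

text \<open>
  Connectedness of a digraph includes that its vertex set is non-empty.
\<close>

definition graphical_building_set :: "('v, 'a) pre_digraph \<Rightarrow> 'v set set" where
  "graphical_building_set G =
     {R. R \<subseteq> verts G \<and> R \<noteq> {} \<and> Digraph_Component.connected (induce_subgraph G R)}"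

text \<open>
  In a symmetric digraph an edge traversed back and forth is a closed walk of length 2 for which
  \<^const>\<open>pre_digraph.cycle\<close> holds; the length bound excludes it.
\<close>

definition chordful :: "('v, 'a) pre_digraph \<Rightarrow> bool" where
  "chordful G \<longleftrightarrow>
     (\<forall>u p. pre_digraph.awalk G u p u \<and> pre_digraph.cycle G p \<and> 3 \<le> length p \<longrightarrow>
        (let C = set (pre_digraph.awalk_verts G u p)
         in complete_digraph (card C) (induce_subgraph G C)))"


section \<open>Nested sets and the nested fan\<close>

text \<open>
  The ground set is the universe. In the second condition a set \<open>X\<close> of at least two members
  stands for the family of the \<open>N\<^sub>i\<close>: since no member of a building set is empty, pairwise
  disjoint members are automatically distinct.
\<close>

definition nested_set :: "'v::finite set set \<Rightarrow> 'v set set \<Rightarrow> bool" where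
  "nested_set \<B> \<N> \<longleftrightarrow>
     \<N> \<subseteq> \<B> - {UNIV} \<and>
     (\<forall>A\<in>\<N>. \<forall>B\<in>\<N>. A \<subseteq> B \<or> B \<subseteq> A \<or> A \<inter> B = {}) \<and>
     (\<forall>X. X \<subseteq> \<N> \<and> 2 \<le> card X \<and> disjoint X \<longrightarrow> \<Union>X \<notin> \<B>)"

definition sum_zero :: "(real ^ 'v::finite) set" where
  "sum_zero = {x. (\<Sum>s\<in>UNIV. x $ s) = 0}"

definition orth_proj :: "'b::euclidean_space set \<Rightarrow> 'b \<Rightarrow> 'b" where
  "orth_proj W x = (THE y. y \<in> W \<and> (\<forall>w\<in>W. orthogonal (x - y) w))"

definition char_vec :: "'v::finite set \<Rightarrow> real ^ 'v" where
  "char_vec R = (\<Sum>r\<in>R. axis r 1)"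

text \<open>
  The convex cone hull of the empty set is \<open>{0}\<close>, which is the cone of the empty nested set.
\<close>

definition nested_fan :: "'v::finite set set \<Rightarrow> (real ^ 'v) set set" where
  "nested_fan \<B> =
     {convex_cone hull ((\<lambda>N. orth_proj sum_zero (char_vec N)) ` \<N>) | \<N>. nested_set \<B> \<N>}"


section \<open>Removahedra and normal fans\<close>

definition removahedron :: "'v::finite set set \<Rightarrow> (real ^ 'v) set" where
  "removahedron \<B> =
     {x. (\<Sum>s\<in>UNIV. x $ s) = real ((CARD('v) + 1) choose 2) \<and>
         (\<forall>B\<in>\<B>. (\<Sum>s\<in>B. x $ s) \<ge> real ((card B + 1) choose 2))}"

definition normal_cone :: "(real ^ 'v::finite) set \<Rightarrow> (real ^ 'v) set \<Rightarrow> (real ^ 'v) set" where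
  "normal_cone P F = {c \<in> sum_zero. \<forall>x\<in>F. \<forall>y\<in>P. c \<bullet> x \<le> c \<bullet> y}"

definition normal_fan :: "(real ^ 'v::finite) set \<Rightarrow> (real ^ 'v) set set" where
  "normal_fan P = {normal_cone P F | F. F face_of P \<and> F \<noteq> {}}"


section \<open>The projection is well defined\<close>

lemma orth_proj_eqI:
  assumes W: "subspace W" and y: "y \<in> W" "\<And>w. w \<in> W \<Longrightarrow> orthogonal (x - y) w"
  shows "orth_proj W x = y"
  unfolding orth_proj_def
proof (rule the_equality)
  show "y \<in> W \<and> (\<forall>w\<in>W. orthogonal (x - y) w)"
    using y by blast
next
  fix z assume z: "z \<in> W \<and> (\<forall>w\<in>W. orthogonal (x - z) w)"
  then have "z - y \<in> W"
    using W y(1) by (simp add: subspace_diff)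
  then have "(x - y) \<bullet> (z - y) = 0" "(x - z) \<bullet> (z - y) = 0"
    using y(2) z by (auto simp: orthogonal_def)
  then have "(z - y) \<bullet> (z - y) = 0"
    by (simp add: inner_diff_left)
  then show "z = y" by simp
qed

lemma subspace_sum_zero: "subspace sum_zero"
  by (auto simp: subspace_def sum_zero_def sum.distrib simp flip: sum_distrib_left)

lemma char_vec_nth: "char_vec R $ s = (if s \<in> R then 1 else 0)"
  by (simp add: char_vec_def axis_def)

lemma orth_proj_char_vec:
  fixes R :: "'v::finite set"
  shows "orth_proj sum_zero (char_vec R) =
    (\<chi> s. (if s \<in> R then 1 else 0) - real (card R) / real CARD('v))"
proof (rule orth_proj_eqI[OF subspace_sum_zero])
  show "(\<chi> s. (if s \<in> R then 1 else 0) - real (card R) / real CARD('v)) \<in> (sum_zero :: (real ^ 'v) set)"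
    by (simp add: sum_zero_def sum_subtractf flip: sum.inter_filter)
next
  fix w :: "real ^ 'v" assume "w \<in> sum_zero"
  then show "orthogonal (char_vec R - (\<chi> s. (if s \<in> R then 1 else 0) - real (card R) / real CARD('v))) w"
    by (simp add: orthogonal_def inner_vec_def char_vec_nth sum_zero_def flip: sum_distrib_left sum_divide_distrib)
qed

end

theory Submission
  imports Defs
begin

text \<open>
  By Farkas' lemma the normal fan of the removahedron consists of the cones spanned by the projected
  characteristic vectors of the proper sets that are tight at some point \<open>x\<close>. A positive combination
  of the vectors of a nested set determines that set through its superlevel sets, so the fans agree
  if and only if the tight sets at every \<open>x\<close> form a nested set; every nested set then occurs, since
  one can pass from a point with more tight sets to one with fewer.

  If \<open>G\<close> is chordful, the building set is closed under non-empty intersections, and strict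
  supermodularity of \<open>|B| (|B| + 1) / 2\<close> makes the tight sets nested. If not, there are connected
  \<open>X\<close>, \<open>Y\<close> with disconnected disjoint union and two further vertices \<open>u\<close>, \<open>v\<close>, each joined to both.
  Tightness of \<open>X\<close>, \<open>Y\<close>, \<open>X \<union> Y \<union> {u}\<close> and \<open>X \<union> Y \<union> {u, v}\<close> leaves the slack \<open>1 - |X| |Y| \<le> 0\<close> at
  \<open>X \<union> Y \<union> {v}\<close>, so this set is tight as well, although it crosses \<open>X \<union> Y \<union> {u}\<close>.
\<close>

section \<open>Projected characteristic vectors and the normal fan of a removahedron\<close>

lemma real_Suc_choose_2: "real (Suc n choose 2) = real n * (real n + 1) / 2"
  by (induction n) (auto simp: choose_two field_simps numeral_2_eq_2)

abbreviation proj_char :: "'v::finite set \<Rightarrow> real ^ 'v"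
  where "proj_char N \<equiv> orth_proj sum_zero (char_vec N)"

lemma proj_char_nth: "proj_char N $ s = of_bool (s \<in> N) - real (card N) / real CARD('v)"
  for N :: "'v::finite set"
  by (simp add: orth_proj_char_vec)

lemma proj_char_mem_sum_zero: "proj_char N \<in> sum_zero"
  unfolding orth_proj_char_vec by (simp add: sum_zero_def sum_subtractf flip: sum.inter_filter)

text \<open>On vectors of one fixed coordinate sum the correction term is constant, so differences
  of this pairing are differences of the sums over \<open>N\<close>.\<close>

lemma inner_proj_char:
  fixes x :: "real ^ 'v::finite"
  shows "proj_char N \<bullet> x = (\<Sum>s\<in>N. x $ s) - real (card N) / real CARD('v) * (\<Sum>s\<in>UNIV. x $ s)"
proof -
  have "(\<Sum>s\<in>UNIV. of_bool (s \<in> N) * x $ s) = (\<Sum>s\<in>N. x $ s)"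
    by (simp add: sum_of_bool_mult_eq)
  then show ?thesis
    by (simp add: inner_vec_def proj_char_nth left_diff_distrib sum_subtractf sum_distrib_left)
qed

section \<open>Finitely generated cones\<close>

text \<open>The multipliers are indexed by \<open>T\<close> and not by the image, so that a weight
  belongs to each set of a family without any appeal to injectivity of \<open>f\<close>.\<close>

lemma convex_cone_hull_finite_image:
  assumes "finite T" "c \<in> convex_cone hull (f ` T)"
  obtains \<mu> where "\<And>N. N \<in> T \<Longrightarrow> \<mu> N \<ge> 0" "c = (\<Sum>N\<in>T. \<mu> N *\<^sub>R f N)"
proof -
  let ?K = "{(\<Sum>N\<in>T. \<mu> N *\<^sub>R f N) | \<mu>. \<forall>N\<in>T. (0::real) \<le> \<mu> N}"
  have "convex_cone hull (f ` T) \<subseteq> ?K"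
  proof (rule hull_minimal)
    show "f ` T \<subseteq> ?K"
    proof clarify
      fix N assume "N \<in> T"
      then have "f N = (\<Sum>M\<in>T. of_bool (M = N) *\<^sub>R f M)"
        using assms(1) by (subst sum.mono_neutral_right[of T "{N}"]) auto
      then show "\<exists>\<mu>. f N = (\<Sum>M\<in>T. \<mu> M *\<^sub>R f M) \<and> (\<forall>N\<in>T. 0 \<le> \<mu> N)"
        by (intro exI[of _ "\<lambda>M. of_bool (M = N)"]) simp
    qed
    show "convex_cone ?K"
      unfolding convex_cone_iff
    proof (intro conjI ballI allI impI)
      show "0 \<in> ?K" by (auto intro!: exI[of _ "\<lambda>_. 0"])
      fix x assume "x \<in> ?K"
      then obtain \<mu> where \<mu>: "x = (\<Sum>N\<in>T. \<mu> N *\<^sub>R f N)" "\<forall>N\<in>T. 0 \<le> \<mu> N" by blast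
      show "a *\<^sub>R x \<in> ?K" if "a \<ge> 0" for a
        using \<mu> that by (auto intro!: exI[of _ "\<lambda>N. a * \<mu> N"] simp: scaleR_sum_right)
      fix y assume "y \<in> ?K"
      then obtain \<nu> where "y = (\<Sum>N\<in>T. \<nu> N *\<^sub>R f N)" "\<forall>N\<in>T. 0 \<le> \<nu> N" by blast
      then show "x + y \<in> ?K"
        using \<mu> by (auto intro!: exI[of _ "\<lambda>N. \<mu> N + \<nu> N"] simp: scaleR_add_left sum.distrib)
    qed
  qed
  then show thesis using assms(2) that by blast
qed

lemma sum_mem_convex_cone_hull:
  assumes "\<And>N. N \<in> T \<Longrightarrow> 0 \<le> \<mu> N"
  shows "(\<Sum>N\<in>T. \<mu> N *\<^sub>R f N) \<in> convex_cone hull (f ` T)"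
  using assms
proof (induction T rule: infinite_finite_induct)
  case (insert N T)
  have "(\<Sum>N\<in>T. \<mu> N *\<^sub>R f N) \<in> convex_cone hull (f ` insert N T)"
    using insert hull_mono[of "f ` T" "f ` insert N T" convex_cone] by auto
  moreover have "\<mu> N *\<^sub>R f N \<in> convex_cone hull (f ` insert N T)"
    using insert by (intro convex_cone_hull_mul hull_inc) auto
  ultimately show ?case using insert by (simp add: convex_cone_hull_add)
qed (auto simp: convex_cone_hull_contains_0)

section \<open>The removahedron as a non-empty compact convex set\<close>

lemma mem_removahedron_iff:
  "x \<in> removahedron \<B> \<longleftrightarrow> (\<Sum>s\<in>UNIV. x $ s) = real ((CARD('v) + 1) choose 2) \<and>
     (\<forall>B\<in>\<B>. real ((card B + 1) choose 2) \<le> (\<Sum>s\<in>B. x $ s))"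
  for x :: "real ^ 'v::finite"
  by (simp add: removahedron_def)

lemma convex_removahedron: "convex (removahedron (\<B> :: 'v::finite set set))"
proof -
  have sum_char: "(\<Sum>s\<in>B. x $ s) = char_vec B \<bullet> x" for B and x :: "real ^ 'v"
    by (simp add: inner_vec_def char_vec_nth sum_of_bool_mult_eq flip: of_bool_def)
  have "removahedron \<B> = {x. char_vec UNIV \<bullet> x = real ((CARD('v) + 1) choose 2)} \<inter>
      (\<Inter>B\<in>\<B>. {x. char_vec B \<bullet> x \<ge> real ((card B + 1) choose 2)})"
    by (auto simp: removahedron_def sum_char)
  then show ?thesis
    by (auto intro!: convex_Int convex_INT convex_hyperplane convex_halfspace_ge)
qed

lemma closed_removahedron: "closed (removahedron \<B>)"
  unfolding removahedron_def Ball_def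
  by (intro closed_Collect_conj closed_Collect_eq closed_Collect_all closed_Collect_imp
      closed_Collect_le open_Collect_const continuous_intros)

text \<open>The inequalities of the singletons force non-negative coordinates, so the l1 norm of a
  point equals the prescribed coordinate sum.\<close>

lemma compact_removahedron:
  assumes "\<And>v. {v} \<in> \<B>"
  shows "compact (removahedron (\<B> :: 'v::finite set set))"
proof -
  have "norm x \<le> real ((CARD('v) + 1) choose 2)" if "x \<in> removahedron \<B>" for x
  proof -
    have pos: "0 \<le> x $ s" for s
      using that assms[of s] by (force simp: mem_removahedron_iff)
    have "norm x \<le> (\<Sum>s\<in>UNIV. \<bar>x $ s\<bar>)" by (rule norm_le_l1_cart)
    also have "\<dots> = real ((CARD('v) + 1) choose 2)"
      using pos that by (simp add: mem_removahedron_iff)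
    finally show ?thesis .
  qed
  then have "bounded (removahedron \<B>)" by (auto simp: bounded_iff)
  then show ?thesis using closed_removahedron by (simp add: compact_eq_bounded_closed)
qed

lemma removahedron_nonempty: "removahedron (\<B> :: 'v::finite set set) \<noteq> {}"
proof -
  let ?n = "real CARD('v)"
  \<comment> \<open>The constant vector with the prescribed total is feasible because |B|(|B|+1)/2
    is at most |B|(n+1)/2.\<close>
  have "(\<chi> s. (?n + 1) / 2) \<in> removahedron \<B>"
    unfolding mem_removahedron_iff
  proof (intro conjI ballI)
    show "(\<Sum>s\<in>UNIV. (\<chi> s::'v. (?n + 1) / 2) $ s) = real ((CARD('v) + 1) choose 2)"
      by (simp add: real_Suc_choose_2)
    fix B :: "'v set"
    have "real (card B) \<le> ?n" by (simp add: card_mono)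
    then have "real (card B) * (real (card B) + 1) \<le> real (card B) * (?n + 1)"
      by (intro mult_left_mono) auto
    then show "real ((card B + 1) choose 2) \<le> (\<Sum>s\<in>B. (\<chi> s::'v. (?n + 1) / 2) $ s)"
      by (simp add: real_Suc_choose_2)
  qed
  then show ?thesis by blast
qed

section \<open>Tight inequalities and normal cones at points\<close>

text \<open>The universe is left out: its equation holds at every point of the removahedron, and its
  projected vector is zero.\<close>

definition tight_sets :: "'v::finite set set \<Rightarrow> real ^ 'v \<Rightarrow> 'v set set" where
  "tight_sets \<B> x = {B \<in> \<B> - {UNIV}. (\<Sum>s\<in>B. x $ s) = real ((card B + 1) choose 2)}"

lemma tight_sets_subset: "tight_sets \<B> x \<subseteq> \<B> - {UNIV}"
  by (auto simp: tight_sets_def)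

text \<open>A slack inequality stays slack for small steps, while a tight one changes by exactly the
  step times the sum of \<open>d\<close> over the set. There are finitely many sets, so one bound on
  the step serves them all.\<close>

lemma eventually_perturb_removahedron:
  fixes x d :: "real ^ 'v::finite"
  assumes x: "x \<in> removahedron \<B>" and d: "d \<in> sum_zero"
    and d_tight: "\<And>B. B \<in> tight_sets \<B> x \<Longrightarrow> 0 \<le> (\<Sum>s\<in>B. d $ s)"
  shows "\<forall>\<^sub>F \<epsilon> in at_right 0. x + \<epsilon> *\<^sub>R d \<in> removahedron \<B> \<and>
     tight_sets \<B> (x + \<epsilon> *\<^sub>R d) = {B \<in> tight_sets \<B> x. (\<Sum>s\<in>B. d $ s) = 0}"
proof -
  let ?f = "\<lambda>B::'v set. real ((card B + 1) choose 2)"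
  have sum_x: "(\<Sum>s\<in>UNIV. x $ s) = ?f UNIV" and sum_d: "(\<Sum>s\<in>UNIV. d $ s) = 0"
    using x d by (simp_all add: mem_removahedron_iff sum_zero_def)
  have sum_perturb: "(\<Sum>s\<in>B. (x + \<epsilon> *\<^sub>R d) $ s) = (\<Sum>s\<in>B. x $ s) + \<epsilon> * (\<Sum>s\<in>B. d $ s)" for B \<epsilon>
    by (simp add: sum.distrib sum_distrib_left)
  have "\<forall>\<^sub>F \<epsilon> in at_right 0. (?f B \<le> (\<Sum>s\<in>B. (x + \<epsilon> *\<^sub>R d) $ s)) \<and>
     (B \<noteq> UNIV \<longrightarrow> ((\<Sum>s\<in>B. (x + \<epsilon> *\<^sub>R d) $ s) = ?f B \<longleftrightarrow> B \<in> tight_sets \<B> x \<and> (\<Sum>s\<in>B. d $ s) = 0))"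
    if B: "B \<in> \<B>" for B
  proof (cases "(\<Sum>s\<in>B. x $ s) = ?f B")
    case True
    show ?thesis
    proof (cases "B = UNIV")
      case False
      then have "B \<in> tight_sets \<B> x" using True B by (simp add: tight_sets_def)
      then show ?thesis
        unfolding sum_perturb
        using d_tight[of B] True eventually_at_right_less[of "0::real"]
        by (auto elim!: eventually_mono)
    qed (use sum_x sum_d sum_perturb[where B = UNIV] in \<open>simp del: vector_add_component\<close>)
  next
    case False
    \<comment> \<open>The term with factor 0 gives the right-hand side the syntactic form of the
      limit as the step tends to 0.\<close>
    then have slack: "?f B < (\<Sum>s\<in>B. x $ s) + 0 * (\<Sum>s\<in>B. d $ s)"
      using x B by (force simp: mem_removahedron_iff)
    have "((\<lambda>\<epsilon>. (\<Sum>s\<in>B. x $ s) + \<epsilon> * (\<Sum>s\<in>B. d $ s)) \<longlongrightarrow>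
        (\<Sum>s\<in>B. x $ s) + 0 * (\<Sum>s\<in>B. d $ s)) (at_right 0)"
      by (intro tendsto_intros)
    from order_tendstoD(1)[OF this slack]
    have "\<forall>\<^sub>F \<epsilon> in at_right 0. ?f B < (\<Sum>s\<in>B. x $ s) + \<epsilon> * (\<Sum>s\<in>B. d $ s)" .
    moreover have "B \<notin> tight_sets \<B> x" using False by (simp add: tight_sets_def)
    ultimately show ?thesis unfolding sum_perturb by (auto elim: eventually_mono)
  qed
  then have "\<forall>\<^sub>F \<epsilon> in at_right 0. \<forall>B\<in>\<B>. (?f B \<le> (\<Sum>s\<in>B. (x + \<epsilon> *\<^sub>R d) $ s)) \<and>
     (B \<noteq> UNIV \<longrightarrow> ((\<Sum>s\<in>B. (x + \<epsilon> *\<^sub>R d) $ s) = ?f B \<longleftrightarrow> B \<in> tight_sets \<B> x \<and> (\<Sum>s\<in>B. d $ s) = 0))"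
    by (intro eventually_ball_finite) auto
  then show ?thesis
  proof eventually_elim
    case (elim \<epsilon>)
    have "(\<Sum>s\<in>UNIV. (x + \<epsilon> *\<^sub>R d) $ s) = ?f UNIV"
      unfolding sum_perturb using sum_x sum_d by simp
    then have "x + \<epsilon> *\<^sub>R d \<in> removahedron \<B>"
      using elim unfolding mem_removahedron_iff by blast
    moreover have "tight_sets \<B> (x + \<epsilon> *\<^sub>R d) = {B \<in> tight_sets \<B> x. (\<Sum>s\<in>B. d $ s) = 0}"
      using elim tight_sets_subset[of \<B> x] unfolding tight_sets_def[of \<B> "x + \<epsilon> *\<^sub>R d"] by blast
    ultimately show ?case ..
  qed
qed

text \<open>This is Farkas' lemma. A vector outside the closed cone of the tight sets is strictly
  separated from it, and the separating functional yields a feasible direction along which that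
  vector decreases.\<close>

lemma normal_cone_removahedron_point:
  fixes x :: "real ^ 'v::finite"
  assumes x: "x \<in> removahedron \<B>"
  shows "normal_cone (removahedron \<B>) {x} = convex_cone hull (proj_char ` tight_sets \<B> x)"
proof (intro equalityI subsetI)
  fix c assume "c \<in> convex_cone hull (proj_char ` tight_sets \<B> x)"
  moreover have "convex_cone hull (proj_char ` tight_sets \<B> x) \<subseteq> normal_cone (removahedron \<B>) {x}"
  proof (rule hull_minimal)
    show "proj_char ` tight_sets \<B> x \<subseteq> normal_cone (removahedron \<B>) {x}"
      using x by (auto simp: normal_cone_def proj_char_mem_sum_zero inner_proj_char
          mem_removahedron_iff tight_sets_def)
    show "convex_cone (normal_cone (removahedron \<B>) {x})"
      using subspace_sum_zero
      by (auto simp: convex_cone_iff normal_cone_def subspace_def inner_add_left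
          intro!: add_mono mult_left_mono)
  qed
  ultimately show "c \<in> normal_cone (removahedron \<B>) {x}" by blast
next
  fix c assume c: "c \<in> normal_cone (removahedron \<B>) {x}"
  let ?K = "convex_cone hull (proj_char ` tight_sets \<B> x)"
  show "c \<in> ?K"
  proof (rule ccontr)
    assume "c \<notin> ?K"
    then obtain a b where a: "a \<bullet> c < b" "\<And>k. k \<in> ?K \<Longrightarrow> b < a \<bullet> k"
      using separating_hyperplane_closed_point[OF convex_convex_cone_hull closed_convex_cone_hull, of "proj_char ` tight_sets \<B> x" c]
      by auto
    have "b < 0" using a(2)[OF convex_cone_hull_contains_0] by simp
    \<comment> \<open>If \<open>k\<close> had a negative value, a positive multiple of it would have
      value exactly \<open>b\<close>, against the strict separation.\<close>
    have a_nonneg: "0 \<le> a \<bullet> k" if "k \<in> ?K" for k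
    proof (rule ccontr)
      assume neg: "\<not> 0 \<le> a \<bullet> k"
      then have "(b / (a \<bullet> k)) *\<^sub>R k \<in> ?K"
        using \<open>b < 0\<close> that by (intro convex_cone_hull_mul) (auto simp: divide_nonpos_neg)
      from a(2)[OF this] neg show False by simp
    qed
    \<comment> \<open>Subtracting the mean projects \<open>a\<close> onto \<open>sum_zero\<close>.
      Steps along \<open>d\<close> then keep the coordinate sum, and pairings with vectors of
      \<open>sum_zero\<close> are unchanged.\<close>
    define d :: "real ^ 'v" where "d = (\<chi> s. a $ s - (\<Sum>s\<in>UNIV. a $ s) / real CARD('v))"
    have d: "d \<in> sum_zero" by (simp add: d_def sum_zero_def sum_subtractf)
    have d_inner: "w \<bullet> d = a \<bullet> w" if "w \<in> sum_zero" for w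
    proof -
      have "(\<Sum>s\<in>UNIV. w $ s * k) = 0" for k
        using that by (simp add: sum_zero_def flip: sum_distrib_right)
      from this[of "(\<Sum>s\<in>UNIV. a $ s) / real CARD('v)"] show ?thesis
        by (simp add: d_def inner_vec_def right_diff_distrib sum_subtractf mult.commute[of "a $ _"])
    qed
    have d_tight: "0 \<le> (\<Sum>s\<in>B. d $ s)" if "B \<in> tight_sets \<B> x" for B
    proof -
      have "(\<Sum>s\<in>B. d $ s) = proj_char B \<bullet> d"
        unfolding inner_proj_char using d by (simp add: sum_zero_def)
      also have "\<dots> = a \<bullet> proj_char B" by (rule d_inner[OF proj_char_mem_sum_zero])
      also have "0 \<le> \<dots>" using that by (intro a_nonneg hull_inc) auto
      finally show ?thesis .
    qed
    have "\<forall>\<^sub>F \<epsilon> in at_right 0. x + \<epsilon> *\<^sub>R d \<in> removahedron \<B>"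
      by (rule eventually_mono[OF eventually_perturb_removahedron[OF x d]]) (simp_all add: d_tight)
    then have "\<forall>\<^sub>F \<epsilon> in at_right 0. x + \<epsilon> *\<^sub>R d \<in> removahedron \<B> \<and> 0 < \<epsilon>"
      using eventually_at_right_less[of "0::real"] by (rule eventually_conj)
    from eventually_happens'[OF trivial_limit_at_right_real this]
    obtain \<epsilon> where \<epsilon>: "x + \<epsilon> *\<^sub>R d \<in> removahedron \<B>" "0 < \<epsilon>" by blast
    then have "c \<bullet> x \<le> c \<bullet> (x + \<epsilon> *\<^sub>R d)" using c by (simp add: normal_cone_def)
    then have "0 \<le> \<epsilon> * (c \<bullet> d)" by (simp add: inner_add_right)
    moreover have "c \<bullet> d < 0" using c d_inner[of c] a(1) \<open>b < 0\<close> by (simp add: normal_cone_def)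
    ultimately show False using \<epsilon>(2) by (simp add: zero_le_mult_iff)
  qed
qed

section \<open>Normal cones of faces\<close>

text \<open>A segment in \<open>F\<close> that ends at a relative interior point \<open>y\<close>
  can be prolonged inside \<open>F\<close>. Minimality of \<open>c\<close> at \<open>y\<close> on
  the prolongation bounds \<open>c\<close> at the other end of the segment from above.\<close>

lemma normal_cone_rel_interior:
  assumes "F \<subseteq> P" "convex F" "y \<in> rel_interior F"
  shows "normal_cone P F = normal_cone P {y}"
proof (intro equalityI subsetI)
  have y: "y \<in> F" using assms(3) rel_interior_subset by blast
  then show "c \<in> normal_cone P {y}" if "c \<in> normal_cone P F" for c
    using that by (simp add: normal_cone_def)
  fix c assume c: "c \<in> normal_cone P {y}"
  have le: "c \<bullet> x \<le> c \<bullet> y" if x: "x \<in> F" for x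
  proof -
    obtain e where e: "e > 1" "(1 - e) *\<^sub>R x + e *\<^sub>R y \<in> F"
      using assms x convex_rel_interior_iff[of F y] by blast
    then have "c \<bullet> y \<le> c \<bullet> ((1 - e) *\<^sub>R x + e *\<^sub>R y)"
      using c assms(1) by (auto simp: normal_cone_def)
    then have "(e - 1) * (c \<bullet> x) \<le> (e - 1) * (c \<bullet> y)"
      by (simp add: inner_add_right algebra_simps)
    then show ?thesis using e(1) by simp
  qed
  have "c \<bullet> x \<le> c \<bullet> z" if "x \<in> F" "z \<in> P" for x z
    using le[OF that(1)] c that(2) by (fastforce simp: normal_cone_def)
  then show "c \<in> normal_cone P F"
    using c by (simp add: normal_cone_def)
qed

text \<open>The last assumption says that all functionals of the cone at \<open>y\<close> are
  constant on the face exposed by \<open>c0\<close>; this lets the cone at a point appear as the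
  cone of a face.\<close>

lemma normal_cone_exposed_face:
  assumes "y \<in> P" "c0 \<in> normal_cone P {y}"
    and "\<And>c x. c \<in> normal_cone P {y} \<Longrightarrow> x \<in> P \<Longrightarrow> c0 \<bullet> x = c0 \<bullet> y \<Longrightarrow> c \<bullet> x = c \<bullet> y"
  shows "normal_cone P (P \<inter> {x. c0 \<bullet> x = c0 \<bullet> y}) = normal_cone P {y}"
proof (intro equalityI subsetI)
  show "c \<in> normal_cone P {y}" if "c \<in> normal_cone P (P \<inter> {x. c0 \<bullet> x = c0 \<bullet> y})" for c
    using that assms(1) by (simp add: normal_cone_def)
  show "c \<in> normal_cone P (P \<inter> {x. c0 \<bullet> x = c0 \<bullet> y})" if "c \<in> normal_cone P {y}" for c
    using assms(3)[OF that] that by (simp add: normal_cone_def)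
qed

text \<open>A face has the normal cone of any of its relative interior points. Conversely, the cone
  at a point is that of the face exposed by the sum of its tight vectors.\<close>

lemma normal_fan_removahedron:
  "normal_fan (removahedron \<B>) = (\<lambda>x. convex_cone hull (proj_char ` tight_sets \<B> x)) ` removahedron \<B>"
  (is "normal_fan ?P = ?C ` ?P")
proof (intro equalityI subsetI)
  fix K assume "K \<in> normal_fan ?P"
  then obtain F where F: "F face_of ?P" "F \<noteq> {}" "K = normal_cone ?P F"
    by (auto simp: normal_fan_def)
  then have "convex F" "F \<subseteq> ?P" by (auto simp: face_of_imp_convex face_of_imp_subset)
  moreover then obtain y where y: "y \<in> rel_interior F" using F(2) rel_interior_eq_empty by blast
  ultimately have "K = normal_cone ?P {y}" "y \<in> ?P"
    using F normal_cone_rel_interior rel_interior_subset by blast+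
  then show "K \<in> ?C ` ?P" using normal_cone_removahedron_point by blast
next
  fix K assume "K \<in> ?C ` ?P"
  then obtain y where y: "y \<in> ?P" "K = ?C y" by blast
  then have K: "K = normal_cone ?P {y}" by (simp add: normal_cone_removahedron_point)
  \<comment> \<open>All weights are positive, so a feasible \<open>x\<close> with the same value of
    \<open>c0\<close> as \<open>y\<close> must attain equality in every inequality tight at
    \<open>y\<close>.\<close>
  define c0 where "c0 = (\<Sum>N\<in>tight_sets \<B> y. 1 *\<^sub>R proj_char N)"
  have c0: "c0 \<in> normal_cone ?P {y}"
    unfolding c0_def normal_cone_removahedron_point[OF y(1)] by (rule sum_mem_convex_cone_hull) simp
  let ?F = "?P \<inter> {x. c0 \<bullet> x = c0 \<bullet> y}"
  have "?F face_of ?P"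
    using c0 by (intro face_of_Int_supporting_hyperplane_ge convex_removahedron) (simp add: normal_cone_def)
  moreover have "y \<in> ?F" using y by simp
  moreover have "normal_cone ?P ?F = normal_cone ?P {y}"
  proof (rule normal_cone_exposed_face[OF y(1) c0])
    fix c x assume c: "c \<in> normal_cone ?P {y}" and x: "x \<in> ?P" "c0 \<bullet> x = c0 \<bullet> y"
    have le: "proj_char N \<bullet> y \<le> proj_char N \<bullet> x" if "N \<in> tight_sets \<B> y" for N
      using that x(1) y(1) by (auto simp: inner_proj_char mem_removahedron_iff tight_sets_def)
    have "(\<Sum>N\<in>tight_sets \<B> y. proj_char N \<bullet> x - proj_char N \<bullet> y) = 0"
      using x(2) by (simp add: c0_def inner_sum_left sum_subtractf)
    then have eq: "proj_char N \<bullet> x = proj_char N \<bullet> y" if "N \<in> tight_sets \<B> y" for N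
      using that le by (subst (asm) sum_nonneg_eq_0_iff) auto
    obtain \<mu> where "c = (\<Sum>N\<in>tight_sets \<B> y. \<mu> N *\<^sub>R proj_char N)"
      using c convex_cone_hull_finite_image[of "tight_sets \<B> y" c proj_char]
      by (auto simp: normal_cone_removahedron_point[OF y(1)])
    then show "c \<bullet> x = c \<bullet> y" using eq by (simp add: inner_sum_left)
  qed
  ultimately show "K \<in> normal_fan ?P" unfolding K normal_fan_def by blast
qed

section \<open>Connected vertex sets\<close>

locale connected_graph_on = graph G for G :: "('v::finite, 'a) pre_digraph" (structure) +
  assumes verts_UNIV: "verts G = UNIV"
    and connected_graph: "Digraph_Component.connected G"
begin

abbreviation adj :: "'v \<Rightarrow> 'v \<Rightarrow> bool" (infix \<open>\<sim>\<close> 50) where "u \<sim> v \<equiv> u \<rightarrow>\<^bsub>G\<^esub> v"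

abbreviation \<B> :: "'v set set" where "\<B> \<equiv> graphical_building_set G"

lemma dominates_sym: "u \<sim> v \<Longrightarrow> v \<sim> u"
  using sym_arcs unfolding symmetric_def by (rule symD)

lemma dominates_irrefl: "\<not> u \<sim> u"
  using no_loops by (auto simp: arcs_ends_def arc_to_ends_def)

lemma arcs_ends_induce: "arcs_ends (G \<restriction> R) = {(u, v). u \<in> R \<and> v \<in> R \<and> u \<sim> v}"
  by (auto simp: arcs_ends_def arc_to_ends_def)

lemma mem_\<B>_iff: "R \<in> \<B> \<longleftrightarrow> R \<noteq> {} \<and>
   (\<forall>u\<in>R. \<forall>v\<in>R. (u, v) \<in> rtrancl_on R {(u, v). u \<in> R \<and> v \<in> R \<and> u \<sim> v})"
proof -
  have "({(u, v). u \<in> R \<and> v \<in> R \<and> u \<sim> v})\<^sup>s = {(u, v). u \<in> R \<and> v \<in> R \<and> u \<sim> v}"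
    using dominates_sym by (auto simp: symcl_def image_iff)
  then show ?thesis
    by (auto simp: graphical_building_set_def connected_conv verts_UNIV arcs_ends_induce)
qed

lemma \<B>_nonempty: "R \<in> \<B> \<Longrightarrow> R \<noteq> {}"
  by (simp add: mem_\<B>_iff)

section \<open>Cuts and unions of connected sets\<close>

lemma \<B>_cut:
  assumes "R \<in> \<B>" "R \<inter> X \<noteq> {}" "\<not> R \<subseteq> X"
  obtains u v where "u \<in> R" "u \<in> X" "v \<in> R" "v \<notin> X" "u \<sim> v"
proof -
  obtain a b where a: "a \<in> R" "a \<in> X" and b: "b \<in> R" "b \<notin> X" using assms by blast
  then have "(a, b) \<in> rtrancl_on R {(u, v). u \<in> R \<and> v \<in> R \<and> u \<sim> v}"
    using assms(1) by (auto simp: mem_\<B>_iff)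
  then have "b \<in> X \<or> (\<exists>u v. u \<in> R \<and> u \<in> X \<and> v \<in> R \<and> v \<notin> X \<and> u \<sim> v)"
    using a by (induction b rule: rtrancl_on_induct) auto
  then show thesis using b(2) that by blast
qed

text \<open>No arc inside \<open>R\<close> leaves the set of vertices reachable from
  \<open>u\<close> inside \<open>R\<close>, so this set cannot be a proper part of
  \<open>R\<close>.\<close>

lemma \<B>_cutI:
  assumes "R \<noteq> {}"
    and "\<And>X. X \<subseteq> R \<Longrightarrow> X \<noteq> {} \<Longrightarrow> X \<noteq> R \<Longrightarrow> \<exists>u\<in>X. \<exists>v\<in>R - X. u \<sim> v"
  shows "R \<in> \<B>"
  unfolding mem_\<B>_iff
proof (intro conjI ballI assms(1))
  fix u v assume uv: "u \<in> R" "v \<in> R"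
  let ?E = "{(u, v). u \<in> R \<and> v \<in> R \<and> u \<sim> v}"
  let ?X = "{w \<in> R. (u, w) \<in> rtrancl_on R ?E}"
  have "?X = R"
  proof (rule ccontr)
    assume "?X \<noteq> R"
    moreover have "?X \<noteq> {}" using uv by auto
    ultimately obtain w z where "w \<in> ?X" "z \<in> R - ?X" "w \<sim> z"
      using assms(2)[of ?X] by auto
    then show False by (auto intro: rtrancl_on_into_rtrancl_on)
  qed
  then show "(u, v) \<in> rtrancl_on R ?E" using uv by blast
qed

lemma UNIV_mem_\<B>: "UNIV \<in> \<B>"
proof -
  have "{e \<in> arcs G. tail G e \<in> verts G \<and> head G e \<in> verts G} = arcs G" by auto
  then have "G \<restriction> UNIV = G" by (simp add: induce_subgraph_def flip: verts_UNIV)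
  with connected_graph show ?thesis by (simp only: graphical_building_set_def verts_UNIV) simp
qed

lemma singleton_mem_\<B>: "{v} \<in> \<B>"
  by (auto intro!: \<B>_cutI)

text \<open>A proper non-empty part of the union either splits \<open>A\<close> or \<open>B\<close>,
  whose own connectedness gives a crossing arc, or is one of the two sides, and then the arc between
  \<open>u\<close> and \<open>v\<close> crosses.\<close>

lemma \<B>_Un_adjacent:
  assumes "A \<in> \<B>" "B \<in> \<B>" "u \<in> A" "v \<in> B" "u \<sim> v"
  shows "A \<union> B \<in> \<B>"
proof (rule \<B>_cutI)
  show "A \<union> B \<noteq> {}" using assms by auto
  fix X assume X: "X \<subseteq> A \<union> B" "X \<noteq> {}" "X \<noteq> A \<union> B"
  note cutA = \<B>_cut[OF assms(1), of X] and cutB = \<B>_cut[OF assms(2), of X]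
  consider "A \<inter> X \<noteq> {}" "\<not> A \<subseteq> X" | "B \<inter> X \<noteq> {}" "\<not> B \<subseteq> X" | "A \<subseteq> X" "B \<inter> X = {}" | "B \<subseteq> X" "A \<inter> X = {}"
    using X by blast
  then show "\<exists>u\<in>X. \<exists>v\<in>A \<union> B - X. u \<sim> v"
  proof cases
    case 1 then show ?thesis by (rule cutA) blast
  next
    case 2 then show ?thesis by (rule cutB) blast
  next
    case 3 then show ?thesis using assms by blast
  next
    case 4 then show ?thesis using assms dominates_sym by blast
  qed
qed

lemma \<B>_Un_meet:
  assumes "A \<in> \<B>" "B \<in> \<B>" "A \<inter> B \<noteq> {}"
  shows "A \<union> B \<in> \<B>"
proof (cases "B \<subseteq> A")
  case False
  obtain u v where "u \<in> B" "u \<in> A" "v \<in> B" "v \<notin> A" "u \<sim> v"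
    by (rule \<B>_cut[OF assms(2), of A]) (use assms(3) False in auto)
  then show ?thesis using \<B>_Un_adjacent assms by blast
qed (use assms in \<open>simp add: Un_absorb2\<close>)

section \<open>Paths and cycles as vertex lists\<close>

text \<open>Vertices may repeat; distinctness is obtained later from minimal length by cutting out
  closed detours.\<close>

definition path_in :: "'v set \<Rightarrow> 'v \<Rightarrow> 'v \<Rightarrow> 'v list \<Rightarrow> bool" where
  "path_in R a b xs \<longleftrightarrow> xs \<noteq> [] \<and> hd xs = a \<and> last xs = b \<and> set xs \<subseteq> R \<and> successively (\<sim>) xs"

lemma path_in_split:
  assumes "path_in R a b (xs @ w # ys)"
  shows "path_in R a w (xs @ [w])" "path_in R w b (w # ys)"
  using assms by (cases xs; auto simp: path_in_def successively_append_iff successively_Cons hd_append)+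

lemma path_in_join:
  assumes "path_in R a w (xs @ [w])" "path_in R w b (w # ys)"
  shows "path_in R a b (xs @ w # ys)"
  using assms by (cases xs; auto simp: path_in_def successively_append_iff successively_Cons hd_append)

lemma path_in_shortcut:
  assumes "path_in R a b (xs @ [w] @ ys @ [w] @ zs)"
  shows "path_in R a b (xs @ w # zs)"
proof (rule path_in_join)
  show "path_in R a w (xs @ [w])"
    using assms path_in_split(1)[of R a b xs w "ys @ w # zs"] by simp
  show "path_in R w b (w # zs)"
    using assms path_in_split(2)[of R a b "xs @ w # ys" w zs] by simp
qed

lemma path_in_ends:
  assumes "path_in R a b xs" "a \<noteq> b"
  shows "\<exists>ys. xs = a # ys @ [b]"
proof -
  obtain zs where zs: "xs = a # zs" using assms by (cases xs) (auto simp: path_in_def)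
  then have "zs = butlast zs @ [b]" using assms by (auto simp: path_in_def split: if_splits)
  then show ?thesis using zs by blast
qed

lemma \<B>_path:
  assumes "R \<in> \<B>" "a \<in> R" "b \<in> R"
  shows "\<exists>xs. path_in R a b xs"
proof -
  have "R \<subseteq> {v. \<exists>xs. path_in R a v xs}"
  proof (rule ccontr)
    assume not_subset: "\<not> R \<subseteq> {v. \<exists>xs. path_in R a v xs}"
    have "path_in R a a [a]" using assms(2) by (simp add: path_in_def)
    then have meet: "R \<inter> {v. \<exists>xs. path_in R a v xs} \<noteq> {}" using assms(2) by blast
    obtain u v where uv: "u \<in> R" "u \<in> {v. \<exists>xs. path_in R a v xs}" "v \<in> R"
        "v \<notin> {v. \<exists>xs. path_in R a v xs}" "u \<sim> v"
      by (rule \<B>_cut[OF assms(1) meet not_subset])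
    then obtain xs where "path_in R a u xs" by blast
    then have "path_in R a v (xs @ [v])" using uv(3,5) by (simp add: path_in_def successively_append_iff)
    then show False using uv(4) by blast
  qed
  then show ?thesis using assms(3) by blast
qed

lemma path_exit:
  "xs \<noteq> [] \<Longrightarrow> successively (\<sim>) xs \<Longrightarrow> hd xs \<in> X \<Longrightarrow> last xs \<notin> X \<Longrightarrow>
    \<exists>u v. u \<in> X \<and> v \<in> set xs \<and> v \<notin> X \<and> u \<sim> v"
proof (induction xs rule: list_nonempty_induct)
  case (cons x xs)
  show ?case
  proof (cases "hd xs \<in> X")
    case True
    then show ?thesis using cons by (auto simp: successively_Cons)
  next
    case False
    then show ?thesis using cons by (intro exI[of _ x] exI[of _ "hd xs"]) (auto simp: successively_Cons)
  qed
qed simp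

lemma awalk_successively:
  "awalk u p v \<Longrightarrow> successively (\<sim>) (awalk_verts u p)"
proof (induction p arbitrary: u)
  case (Cons e p)
  have "e \<in> arcs G" "u = tail G e" "awalk (head G e) p v" using Cons.prems by (auto simp: awalk_Cons_iff)
  moreover have "tail G e \<sim> head G e" using \<open>e \<in> arcs G\<close> by (rule in_arcs_imp_in_arcs_ends)
  moreover have "hd (awalk_verts (head G e) p) = head G e" using \<open>awalk (head G e) p v\<close> by simp
  ultimately show ?case using Cons.IH by (simp add: successively_Cons)
qed simp

lemma successively_awalk:
  "xs \<noteq> [] \<Longrightarrow> successively (\<sim>) xs \<Longrightarrow> \<exists>p. awalk (hd xs) p (last xs) \<and> awalk_verts (hd xs) p = xs"
proof (induction xs rule: list_nonempty_induct)
  case (single x)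
  then show ?case by (intro exI[of _ "[]"]) (simp add: awalk_Nil_iff verts_UNIV)
next
  case (cons x xs)
  then obtain p where p: "awalk (hd xs) p (last xs)" "awalk_verts (hd xs) p = xs"
    by (auto simp: successively_Cons)
  obtain e where "e \<in> arcs G" "tail G e = x" "head G e = hd xs"
    using cons by (auto simp: successively_Cons arcs_ends_def arc_to_ends_def)
  then show ?case using p cons by (intro exI[of _ "e # p"]) (auto simp: awalk_Cons_iff)
qed

text \<open>This replaces cycles given as arc lists by distinct vertex lists whose last vertex is
  joined to the first, a form that can be cut and glued.\<close>

lemma chordful_iff:
  "chordful G \<longleftrightarrow> (\<forall>xs a c. distinct xs \<and> 3 \<le> length xs \<and> successively (\<sim>) xs \<and> last xs \<sim> hd xs
     \<and> a \<in> set xs \<and> c \<in> set xs \<and> a \<noteq> c \<longrightarrow> a \<sim> c)"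
proof -
  have complete: "complete_digraph (card C) (G \<restriction> C) \<longleftrightarrow> (\<forall>a\<in>C. \<forall>c\<in>C. a \<noteq> c \<longrightarrow> a \<sim> c)" for C
  proof -
    have "graph (G \<restriction> C)"
      using digraphI_induced[of "G \<restriction> C"] wf_digraphI_induced[of "G \<restriction> C"] induced_graph_imp_symmetric[of G "G \<restriction> C"] sym_arcs
        induced_induce[of C] by (simp add: verts_UNIV graph_def pseudo_graph_def sym_digraph_def sym_digraph_axioms_def digraph_def)
    then show ?thesis
      using dominates_irrefl by (auto simp: complete_digraph_def arcs_ends_induce)
  qed
  show ?thesis
  proof
    assume ch: "chordful G"
    show "\<forall>xs a c. distinct xs \<and> 3 \<le> length xs \<and> successively (\<sim>) xs \<and> last xs \<sim> hd xs
     \<and> a \<in> set xs \<and> c \<in> set xs \<and> a \<noteq> c \<longrightarrow> a \<sim> c"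
    proof (intro allI impI, elim conjE)
      fix xs a c
      assume xs: "distinct xs" "3 \<le> length xs" "successively (\<sim>) xs" "last xs \<sim> hd xs"
        and ac: "a \<in> set xs" "c \<in> set xs" "a \<noteq> c"
      \<comment> \<open>Prepending the last vertex closes the walk and leaves \<open>xs\<close> as
        the tail of the vertex list, the part on which \<open>cycle\<close> demands
        distinctness.\<close>
      let ?ys = "last xs # xs"
      have ne: "xs \<noteq> []" using xs by auto
      then have "successively (\<sim>) ?ys" using xs by (simp add: successively_Cons)
      then obtain p where p: "awalk (last xs) p (last xs)" "awalk_verts (last xs) p = ?ys"
        using successively_awalk[of ?ys] ne by auto
      have "length p = length xs" using p(2) length_awalk_verts[of "last xs" p] by simp
      then have "pre_digraph.cycle G p" using p xs unfolding cycle_def by auto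
      then have "complete_digraph (card (set ?ys)) (G \<restriction> set ?ys)"
        using ch p xs \<open>length p = length xs\<close> unfolding chordful_def Let_def by metis
      then show "a \<sim> c" using ac by (auto simp: complete)
    qed
  next
    assume *: "\<forall>xs a c. distinct xs \<and> 3 \<le> length xs \<and> successively (\<sim>) xs \<and> last xs \<sim> hd xs
     \<and> a \<in> set xs \<and> c \<in> set xs \<and> a \<noteq> c \<longrightarrow> a \<sim> c"
    show "chordful G"
      unfolding chordful_def Let_def complete
    proof (intro allI impI ballI, elim conjE)
      fix u p a c
      assume p: "awalk u p u" "pre_digraph.cycle G p" "3 \<le> length p"
        and ac: "a \<in> set (awalk_verts u p)" "c \<in> set (awalk_verts u p)" "a \<noteq> c"
      obtain e q where eq: "p = e # q" using p(3) by (cases p) auto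
      define xs where "xs = awalk_verts (head G e) q"
      have u: "u = tail G e" using p(1) eq by (auto simp: awalk_Cons_iff)
      have dist: "distinct xs" using p(2) eq by (auto simp: cycle_def xs_def)
      have len: "length xs = length p" by (simp add: xs_def length_awalk_verts eq)
      have "awalk (head G e) q u" "e \<in> arcs G" using p(1) eq by (auto simp: awalk_Cons_iff)
      then have "successively (\<sim>) xs" "last xs = u" "hd xs = head G e" "u \<sim> head G e"
        by (auto simp: xs_def awalk_successively u in_arcs_imp_in_arcs_ends)
      moreover have "set (awalk_verts u p) = set xs"
        using \<open>last xs = u\<close> eq u last_in_set[of xs] by (auto simp: xs_def)
      ultimately show "a \<sim> c" using *[rule_format, of xs a c] ac dist len p(3) by simp
    qed
  qed
qed

section \<open>Nested sets\<close>

text \<open>For graphical building sets the condition on families reduces to pairs: if the union of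
  a disjoint family is connected, some arc leaves a member \<open>M\<close> for another member
  \<open>N\<close>, and then \<open>M \<union> N\<close> is connected already.\<close>

lemma nested_set_\<B>_iff:
  "nested_set \<B> T \<longleftrightarrow> T \<subseteq> \<B> - {UNIV} \<and>
     (\<forall>A\<in>T. \<forall>B\<in>T. A \<subseteq> B \<or> B \<subseteq> A \<or> A \<inter> B = {} \<and> A \<union> B \<notin> \<B>)"
proof
  assume nested: "nested_set \<B> T"
  show "T \<subseteq> \<B> - {UNIV} \<and> (\<forall>A\<in>T. \<forall>B\<in>T. A \<subseteq> B \<or> B \<subseteq> A \<or> A \<inter> B = {} \<and> A \<union> B \<notin> \<B>)"
  proof (intro conjI ballI)
    show "T \<subseteq> \<B> - {UNIV}" using nested by (simp add: nested_set_def)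
    fix A B assume AB: "A \<in> T" "B \<in> T"
    have nested_or_disjoint: "A \<subseteq> B \<or> B \<subseteq> A \<or> A \<inter> B = {}"
      and no_union: "\<And>X. X \<subseteq> T \<and> 2 \<le> card X \<and> disjoint X \<Longrightarrow> \<Union>X \<notin> \<B>"
      using nested AB by (simp_all add: nested_set_def)
    show "A \<subseteq> B \<or> B \<subseteq> A \<or> A \<inter> B = {} \<and> A \<union> B \<notin> \<B>"
    proof (cases "A \<subseteq> B \<or> B \<subseteq> A")
      case False
      then have disj: "A \<inter> B = {}" using nested_or_disjoint by blast
      have "A \<noteq> B" using False by blast
      then have "2 \<le> card {A, B}" "disjoint {A, B}" using disj by (simp_all add: disjoint_def Int_commute)
      then have "\<Union>{A, B} \<notin> \<B>" using AB by (intro no_union) simp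
      then show ?thesis using disj by simp
    qed blast
  qed
next
  assume pairs: "T \<subseteq> \<B> - {UNIV} \<and> (\<forall>A\<in>T. \<forall>B\<in>T. A \<subseteq> B \<or> B \<subseteq> A \<or> A \<inter> B = {} \<and> A \<union> B \<notin> \<B>)"
  have T_\<B>: "N \<in> \<B>" if "N \<in> T" for N using pairs that by auto
  have "\<Union>X \<notin> \<B>" if X: "X \<subseteq> T" "2 \<le> card X" "disjoint X" for X
  proof
    assume UX: "\<Union>X \<in> \<B>"
    have "\<not> card X \<le> Suc 0" using X(2) by simp
    then obtain M M' where M: "M \<in> X" "M' \<in> X" "M \<noteq> M'"
      unfolding card_le_Suc0_iff_eq[OF finite] by blast
    have "M \<noteq> {}" "M' \<noteq> {}" using M(1,2) X(1) by (auto intro!: \<B>_nonempty T_\<B>)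
    moreover have "M \<inter> M' = {}" using X(3) M by (rule disjointD)
    ultimately have "\<Union>X \<inter> M \<noteq> {}" "\<not> \<Union>X \<subseteq> M" using M by auto
    from this obtain u v where uv: "u \<in> \<Union>X" "u \<in> M" "v \<in> \<Union>X" "v \<notin> M" "u \<sim> v"
      by (rule \<B>_cut[OF UX])
    then obtain N where N: "N \<in> X" "v \<in> N" by blast
    then have "M \<noteq> N" using uv(4) by blast
    with X(3) M(1) N(1) have "M \<inter> N = {}" by (rule disjointD)
    have "M \<in> T" "N \<in> T" using M(1) N(1) X(1) by auto
    have "M \<union> N \<in> \<B>"
      using T_\<B>[OF \<open>M \<in> T\<close>] T_\<B>[OF \<open>N \<in> T\<close>] uv(2) N(2) uv(5) by (rule \<B>_Un_adjacent)
    then have "M \<subseteq> N \<or> N \<subseteq> M"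
      using conjunct2[OF pairs, rule_format, OF \<open>M \<in> T\<close> \<open>N \<in> T\<close>] by simp
    then show False using \<open>M \<inter> N = {}\<close> uv(2) N(2) by auto
  qed
  moreover have "A \<subseteq> B \<or> B \<subseteq> A \<or> A \<inter> B = {}" if "A \<in> T" "B \<in> T" for A B
    using conjunct2[OF pairs, rule_format, OF that] by auto
  ultimately show "nested_set \<B> T" using pairs unfolding nested_set_def by simp
qed

lemma nested_set_mem_\<B>: "nested_set \<B> T \<Longrightarrow> N \<in> T \<Longrightarrow> N \<in> \<B>"
  by (auto simp: nested_set_def)

lemma nested_set_neq_UNIV: "nested_set \<B> T \<Longrightarrow> N \<in> T \<Longrightarrow> N \<noteq> UNIV"
  by (auto simp: nested_set_def)

lemma nested_set_cases:
  "nested_set \<B> T \<Longrightarrow> A \<in> insert UNIV T \<Longrightarrow> B \<in> insert UNIV T \<Longrightarrow>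
    A \<subseteq> B \<or> B \<subseteq> A \<or> A \<inter> B = {} \<and> A \<union> B \<notin> \<B>"
  unfolding nested_set_\<B>_iff by (elim insertE) simp_all

lemma insert_UNIV_mem_\<B>: "nested_set \<B> T \<Longrightarrow> N \<in> insert UNIV T \<Longrightarrow> N \<in> \<B>"
  using nested_set_mem_\<B> UNIV_mem_\<B> by auto

lemma nested_set_subset: "nested_set \<B> T \<Longrightarrow> S \<subseteq> T \<Longrightarrow> nested_set \<B> S"
  unfolding nested_set_\<B>_iff by (simp add: subset_iff)

lemma nested_set_singleton: "B \<in> \<B> - {UNIV} \<Longrightarrow> nested_set \<B> {B}"
  by (simp add: nested_set_\<B>_iff)

section \<open>Smallest members and recovery of a nested set from its weighted sum\<close>

text \<open>Adding the universe as a root guarantees that every vertex lies in some member, and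
  turns the nested set into a tree under inclusion.\<close>

definition smallest :: "'v set set \<Rightarrow> 'v \<Rightarrow> 'v set" where
  "smallest T v = \<Inter>{N \<in> insert UNIV T. v \<in> N}"

lemma mem_smallest: "v \<in> smallest T v"
  by (simp add: smallest_def)

lemma smallest_subset: "N \<in> insert UNIV T \<Longrightarrow> v \<in> N \<Longrightarrow> smallest T v \<subseteq> N"
  unfolding smallest_def by blast

text \<open>Members through \<open>v\<close> meet, hence form a chain, and the least element of a
  finite chain is its intersection.\<close>

lemma smallest_mem:
  assumes "nested_set \<B> T"
  shows "smallest T v \<in> insert UNIV T"
proof -
  let ?C = "{N \<in> insert UNIV T. v \<in> N}"
  obtain M where M: "M \<in> ?C" "\<And>N. N \<in> ?C \<Longrightarrow> N \<subseteq> M \<Longrightarrow> M = N"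
    using finite_has_minimal[of ?C] by (metis (no_types, lifting) UNIV_I empty_iff finite insertI1 mem_Collect_eq)
  have "M \<subseteq> N" if "N \<in> ?C" for N
  proof -
    have "M \<subseteq> N \<or> N \<subseteq> M" using nested_set_cases[OF assms, of M N] M(1) that by auto
    then show ?thesis using M(2)[OF that] by blast
  qed
  then have "smallest T v = M" using M(1) unfolding smallest_def by blast
  then show ?thesis using M(1) by simp
qed

lemma smallest_mem_\<B>: "nested_set \<B> T \<Longrightarrow> smallest T v \<in> \<B>"
  by (rule insert_UNIV_mem_\<B>[OF _ smallest_mem])

lemma nested_adjacent:
  assumes "nested_set \<B> T" "A \<in> insert UNIV T" "B \<in> insert UNIV T" "u \<in> A" "v \<in> B" "u \<sim> v"
  shows "A \<subseteq> B \<or> B \<subseteq> A"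
proof -
  have "A \<union> B \<in> \<B>"
    using insert_UNIV_mem_\<B>[OF assms(1,2)] insert_UNIV_mem_\<B>[OF assms(1,3)] assms(4-6) by (rule \<B>_Un_adjacent)
  then show ?thesis using nested_set_cases[OF assms(1-3)] by simp
qed

text \<open>Every member has a private vertex, one in no smaller member. Otherwise take a largest
  set \<open>smallest T r\<close> with \<open>r\<close> in \<open>N\<close>: an arc inside
  \<open>N\<close> leaves it, and the smallest member at the far end is comparable to it, hence
  strictly larger.\<close>

lemma ex_smallest_eq:
  assumes nested: "nested_set \<B> T" and N: "N \<in> insert UNIV T"
  shows "\<exists>r\<in>N. smallest T r = N"
proof (rule ccontr)
  assume "\<not> (\<exists>r\<in>N. smallest T r = N)"
  then have neq: "smallest T r \<noteq> N" if "r \<in> N" for r using that by blast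
  have N_\<B>: "N \<in> \<B>" using nested N by (rule insert_UNIV_mem_\<B>)
  then have "N \<noteq> {}" by (rule \<B>_nonempty)
  then obtain r where r: "r \<in> N" "\<And>s. s \<in> N \<Longrightarrow> smallest T r \<subseteq> smallest T s \<Longrightarrow> smallest T r = smallest T s"
    using finite_has_maximal[of "smallest T ` N"] by (metis (no_types, lifting) finite image_iff image_is_empty)
  have "smallest T r \<subseteq> N" using smallest_subset[OF N r(1)] .
  then have "N \<inter> smallest T r \<noteq> {}" "\<not> N \<subseteq> smallest T r" using neq[OF r(1)] r(1) mem_smallest[of r T] by blast+
  then obtain u w where uw: "u \<in> N" "u \<in> smallest T r" "w \<in> N" "w \<notin> smallest T r" "u \<sim> w"
    by (rule \<B>_cut[OF N_\<B>])
  have "smallest T r \<subseteq> smallest T w \<or> smallest T w \<subseteq> smallest T r"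
    using nested_adjacent[OF nested smallest_mem[OF nested] smallest_mem[OF nested] uw(2) mem_smallest uw(5)] .
  then show False using r(2)[OF uw(3)] uw(4) mem_smallest[of w T] by blast
qed

text \<open>
  The constant \<open>k\<close> accounts for the projection onto \<^const>\<open>sum_zero\<close>. The two inequalities below say that
  \<open>smallest T v\<close> is the connected component of \<open>v\<close> in the superlevel set \<open>{z. c v \<le> c z}\<close>, so that it
  depends only on \<open>c\<close>.
\<close>

definition nested_weights :: "'v set set \<Rightarrow> ('v \<Rightarrow> real) \<Rightarrow> bool" where
  "nested_weights T c \<longleftrightarrow> nested_set \<B> T \<and>
     (\<exists>wt k. (\<forall>N\<in>T. 0 < wt N) \<and> (\<forall>v. c v = (\<Sum>N\<in>{N\<in>T. v \<in> N}. wt N) - k))"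

lemma nested_weights_le:
  assumes "nested_weights T c" "z \<in> smallest T v"
  shows "c v \<le> c z"
proof -
  obtain wt k where wt: "\<forall>N\<in>T. 0 < wt N" "\<And>v. c v = (\<Sum>N\<in>{N\<in>T. v \<in> N}. wt N) - k"
    using assms(1) unfolding nested_weights_def by blast
  have "{N\<in>T. v \<in> N} \<subseteq> {N\<in>T. z \<in> N}"
    using assms(2) smallest_subset[of _ T v] by blast
  then show ?thesis unfolding wt(2) using wt(1)
    by (intro diff_right_mono sum_mono2) (auto simp: less_imp_le)
qed

text \<open>The arc makes the smallest members of \<open>v\<close> and \<open>w\<close> comparable,
  so each member through \<open>w\<close> also contains \<open>v\<close>, while
  \<open>smallest T v\<close> itself contributes its positive weight to \<open>v\<close>
  only.\<close>

lemma nested_weights_less: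
  assumes "nested_weights T c" "z \<in> smallest T v" "w \<notin> smallest T v" "z \<sim> w"
  shows "c w < c v"
proof -
  obtain wt k where nested: "nested_set \<B> T"
    and wt: "\<forall>N\<in>T. 0 < wt N" "\<And>v. c v = (\<Sum>N\<in>{N\<in>T. v \<in> N}. wt N) - k"
    using assms(1) unfolding nested_weights_def by blast
  let ?M = "smallest T v"
  have "?M \<subseteq> smallest T w \<or> smallest T w \<subseteq> ?M"
    using nested_adjacent[OF nested smallest_mem[OF nested] smallest_mem[OF nested] assms(2) mem_smallest assms(4)] .
  then have "?M \<subseteq> smallest T w" using assms(3) mem_smallest[of w T] by blast
  then have subset: "{N\<in>T. w \<in> N} \<subseteq> {N\<in>T. v \<in> N}"
    using smallest_subset[of _ T w] mem_smallest[of v T] by blast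
  have "?M \<in> T" using smallest_mem[OF nested, of v] assms(3) by auto
  then have M: "?M \<in> {N\<in>T. v \<in> N} - {N\<in>T. w \<in> N}" using assms(3) mem_smallest[of v T] by blast
  have "(\<Sum>N\<in>{N\<in>T. w \<in> N}. wt N) < (\<Sum>N\<in>{N\<in>T. v \<in> N}. wt N)"
    using wt(1) M by (intro sum_strict_mono2[OF finite subset M]) (simp_all add: less_imp_le)
  then show ?thesis by (simp add: wt(2))
qed

text \<open>If the connected set \<open>smallest T' v\<close> left \<open>smallest T v\<close>, an
  arc would lead out to some \<open>w\<close>. Then \<open>T\<close> makes \<open>c\<close> smaller
  at \<open>w\<close> than at \<open>v\<close>, and \<open>T'\<close> makes it at least as
  large.\<close>

lemma nested_weights_smallest_subset:
  assumes "nested_weights T c" "nested_weights T' c"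
  shows "smallest T' v \<subseteq> smallest T v"
proof (rule ccontr)
  assume not_subset: "\<not> smallest T' v \<subseteq> smallest T v"
  have meet: "smallest T' v \<inter> smallest T v \<noteq> {}" using mem_smallest[of v] by blast
  have "smallest T' v \<in> \<B>" using assms(2) smallest_mem_\<B> by (simp add: nested_weights_def)
  then obtain z w where zw: "z \<in> smallest T' v" "z \<in> smallest T v" "w \<in> smallest T' v" "w \<notin> smallest T v" "z \<sim> w"
    using meet not_subset by (rule \<B>_cut)
  have "c w < c v" using nested_weights_less[OF assms(1) zw(2,4,5)] .
  moreover have "c v \<le> c w" using nested_weights_le[OF assms(2) zw(3)] .
  ultimately show False by simp
qed

text \<open>Every member is the smallest one of its private vertex, so the function
  \<open>smallest\<close> determines the family.\<close>

lemma nested_weights_unique: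
  assumes "nested_weights T c" "nested_weights T' c"
  shows "T = T'"
proof -
  have smallest_eq: "smallest T v = smallest T' v" for v
    using assms nested_weights_smallest_subset by blast
  have "S \<subseteq> S'" if "nested_weights S c" "nested_weights S' c" "\<And>v. smallest S v = smallest S' v" for S S'
  proof
    fix N assume N: "N \<in> S"
    have nested: "nested_set \<B> S" "nested_set \<B> S'" using that by (simp_all add: nested_weights_def)
    obtain r where "smallest S r = N" using ex_smallest_eq[OF nested(1), of N] N by blast
    then have "N \<in> insert UNIV S'" using that(3) smallest_mem[OF nested(2), of r] by simp
    then show "N \<in> S'" using N nested_set_neq_UNIV[OF nested(1)] by auto
  qed
  from this[OF assms smallest_eq] this[OF assms(2,1) smallest_eq[symmetric]] show ?thesis by blast
qed

lemma nested_weights_sum: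
  assumes "nested_set \<B> T" "\<And>N. N \<in> T \<Longrightarrow> 0 < wt N"
  shows "nested_weights T (($) (\<Sum>N\<in>T. wt N *\<^sub>R proj_char N))"
proof -
  have "(\<Sum>N\<in>T. wt N *\<^sub>R proj_char N) $ v =
     (\<Sum>N\<in>{N\<in>T. v \<in> N}. wt N) - (\<Sum>N\<in>T. wt N * (real (card N) / real CARD('v)))" for v
  proof -
    have "(\<Sum>N\<in>T. wt N *\<^sub>R proj_char N) $ v =
        (\<Sum>N\<in>T. wt N * of_bool (v \<in> N)) - (\<Sum>N\<in>T. wt N * (real (card N) / real CARD('v)))"
      by (simp only: sum_component vector_scaleR_component real_scaleR_def proj_char_nth right_diff_distrib sum_subtractf)
    also have "(\<Sum>N\<in>T. wt N * of_bool (v \<in> N)) = (\<Sum>N\<in>{N\<in>T. v \<in> N}. wt N)"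
      by (simp add: sum_mult_of_bool_eq Int_def conj_commute)
    finally show ?thesis .
  qed
  then show ?thesis using assms unfolding nested_weights_def by blast
qed

text \<open>Dropping zero weights from a representation over \<open>T\<close> leaves a nested
  subfamily with positive weights and the same sum, which by uniqueness is \<open>S\<close>.\<close>

lemma nested_weights_support:
  assumes "nested_weights S (($) c)" "nested_set \<B> T" "c \<in> convex_cone hull (proj_char ` T)"
  shows "S \<subseteq> T"
proof -
  obtain wt where wt: "\<And>N. N \<in> T \<Longrightarrow> wt N \<ge> 0" "c = (\<Sum>N\<in>T. wt N *\<^sub>R proj_char N)"
    using convex_cone_hull_finite_image[OF _ assms(3)] by auto
  let ?T = "{N\<in>T. 0 < wt N}"
  have c_eq: "c = (\<Sum>N\<in>?T. wt N *\<^sub>R proj_char N)"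
    unfolding wt(2) using wt(1) by (intro sum.mono_neutral_right) (auto simp: order_less_le)
  have "nested_set \<B> ?T" using assms(2) by (rule nested_set_subset) auto
  then have "nested_weights ?T (($) c)" unfolding c_eq by (rule nested_weights_sum) simp
  with assms(1) have "S = ?T" by (rule nested_weights_unique)
  then show ?thesis by blast
qed

section \<open>Comparison of the two fans\<close>

text \<open>\<open>S\<close> is not assumed nested. Each generator of \<open>S\<close> is the
  weighted sum of a one-member nested set and lies in the cone of \<open>T\<close>, so its set
  belongs to \<open>T\<close>; hence \<open>S\<close> is nested and the roles can be
  exchanged.\<close>

lemma nested_cone_eq_imp_eq:
  assumes nested: "nested_set \<B> T" and S: "S \<subseteq> \<B> - {UNIV}"
    and cones: "convex_cone hull (proj_char ` S) = convex_cone hull (proj_char ` T)"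
  shows "S = T"
proof
  show "S \<subseteq> T"
  proof
    fix B assume B: "B \<in> S"
    then have "proj_char B \<in> convex_cone hull (proj_char ` T)"
      unfolding cones[symmetric] by (intro hull_inc) auto
    moreover have "nested_weights {B} (($) (proj_char B))"
      using nested_weights_sum[OF nested_set_singleton, of B "\<lambda>_. 1"] B S by auto
    ultimately show "B \<in> T" using nested_weights_support nested by blast
  qed
  then have "nested_set \<B> S" by (rule nested_set_subset[OF nested])
  moreover have "(\<Sum>N\<in>T. 1 *\<^sub>R proj_char N) \<in> convex_cone hull (proj_char ` S)"
    unfolding cones by (rule sum_mem_convex_cone_hull) simp
  ultimately show "T \<subseteq> S"
    using nested_weights_support nested_weights_sum[OF nested, of "\<lambda>_. 1"] by simp
qed

lemma nested_set_separating_direction: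
  assumes nested: "nested_set \<B> T" and B: "B \<in> T"
  obtains d where "d \<in> sum_zero" "\<And>M. M \<in> T \<Longrightarrow> (\<Sum>s\<in>M. d $ s) = of_bool (M = B)"
proof -
  \<comment> \<open>Move mass to a vertex private to \<open>B\<close> from one private to the parent \<open>Q\<close> of \<open>B\<close>.\<close>
  have "nested_set \<B> (T - {B})" using nested by (rule nested_set_subset) auto
  have "B \<noteq> UNIV" using nested B by (rule nested_set_neq_UNIV)
  obtain r where r: "r \<in> B" "smallest T r = B" using ex_smallest_eq[OF nested, of B] B by blast
  \<comment> \<open>With \<open>B\<close> deleted, \<open>Q\<close> is the least remaining member
    through \<open>r\<close>, so any other member through \<open>r\<close> contains it.\<close>
  define Q where "Q = smallest (T - {B}) r"
  have Q: "Q \<in> insert UNIV (T - {B})" "r \<in> Q"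
    using smallest_mem[OF \<open>nested_set \<B> (T - {B})\<close>] mem_smallest by (auto simp: Q_def)
  obtain q where q: "q \<in> Q" "smallest T q = Q" using ex_smallest_eq[OF nested, of Q] Q by blast
  \<comment> \<open>If \<open>q\<close> were in \<open>B\<close>, then \<open>Q\<close> and
    \<open>B\<close> would contain each other, although \<open>Q\<close> was chosen after deleting
    \<open>B\<close>.\<close>
  have "q \<notin> B"
  proof
    assume "q \<in> B"
    then have "Q \<subseteq> B" using q smallest_subset[of B T q] B by simp
    moreover have "B \<subseteq> Q" using r Q smallest_subset[of Q T r] by auto
    ultimately show False using Q \<open>B \<noteq> UNIV\<close> by blast
  qed
  have "r \<in> M \<longleftrightarrow> q \<in> M" if "M \<in> T" "M \<noteq> B" for M
  proof
    assume "r \<in> M"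
    then have "Q \<subseteq> M" unfolding Q_def using that by (intro smallest_subset) auto
    then show "q \<in> M" using q by blast
  next
    assume "q \<in> M"
    then have "Q \<subseteq> M" using that q smallest_subset[of M T q] by auto
    then show "r \<in> M" using Q by blast
  qed
  moreover have "(\<Sum>s\<in>M. (axis r 1 - axis q 1 :: real ^ 'v) $ s) = of_bool (r \<in> M) - of_bool (q \<in> M)" for M
    by (simp add: sum_subtractf axis_def)
  ultimately show thesis
    using that[of "axis r 1 - axis q 1"] r \<open>q \<notin> B\<close> by (auto simp: sum_zero_def simp del: vector_minus_component)
qed

abbreviation "P \<equiv> removahedron \<B>"

lemma ex_tight_sets_eq:
  assumes all_nested: "\<And>x. x \<in> P \<Longrightarrow> nested_set \<B> (tight_sets \<B> x)" and nested: "nested_set \<B> T"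
  obtains x where "x \<in> P" "tight_sets \<B> x = T"
proof -
  define c where "c = (\<Sum>N\<in>T. 1 *\<^sub>R proj_char N)"
  have c: "nested_weights T (($) c)" unfolding c_def by (rule nested_weights_sum[OF nested]) simp
  have "c \<in> sum_zero" unfolding c_def
    by (intro subspace_sum subspace_sum_zero subspace_scale proj_char_mem_sum_zero)
  have "\<exists>x\<in>P. \<forall>y\<in>P. c \<bullet> x \<le> c \<bullet> y"
    by (intro continuous_attains_inf compact_removahedron removahedron_nonempty singleton_mem_\<B> continuous_intros)
  then obtain x where x: "x \<in> P" "\<And>y. y \<in> P \<Longrightarrow> c \<bullet> x \<le> c \<bullet> y" by blast
  have "c \<in> normal_cone P {x}" using x \<open>c \<in> sum_zero\<close> by (simp add: normal_cone_def)
  then have "T \<subseteq> tight_sets \<B> x"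
    using nested_weights_support[OF c all_nested] x(1) by (simp add: normal_cone_removahedron_point)
  with x(1) have "x \<in> P \<and> T \<subseteq> tight_sets \<B> x" ..
  from ex_has_least_nat[of "\<lambda>x. x \<in> P \<and> T \<subseteq> tight_sets \<B> x", OF this, of "\<lambda>x. card (tight_sets \<B> x)"]
  obtain y where y: "y \<in> P" "T \<subseteq> tight_sets \<B> y"
    and least: "\<And>z. z \<in> P \<Longrightarrow> T \<subseteq> tight_sets \<B> z \<Longrightarrow> card (tight_sets \<B> y) \<le> card (tight_sets \<B> z)"
    by blast
  have "tight_sets \<B> y \<subseteq> T"
  proof (rule ccontr)
    assume "\<not> tight_sets \<B> y \<subseteq> T"
    then obtain B where B: "B \<in> tight_sets \<B> y" "B \<notin> T" by blast
    obtain d where d: "d \<in> sum_zero" "\<And>M. M \<in> tight_sets \<B> y \<Longrightarrow> (\<Sum>s\<in>M. d $ s) = of_bool (M = B)"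
      using nested_set_separating_direction[OF all_nested[OF y(1)] B(1)] by blast
    have "\<forall>\<^sub>F \<epsilon> in at_right 0. y + \<epsilon> *\<^sub>R d \<in> P \<and>
        tight_sets \<B> (y + \<epsilon> *\<^sub>R d) = {M \<in> tight_sets \<B> y. (\<Sum>s\<in>M. d $ s) = 0}"
      by (rule eventually_perturb_removahedron[OF y(1) d(1)]) (simp add: d(2))
    from eventually_happens'[OF trivial_limit_at_right_real this]
    obtain z where z: "z \<in> P" "tight_sets \<B> z = {M \<in> tight_sets \<B> y. (\<Sum>s\<in>M. d $ s) = 0}" by blast
    have "tight_sets \<B> z = tight_sets \<B> y - {B}"
      unfolding z(2) using d(2) by auto
    moreover from this have "card (tight_sets \<B> y) \<le> card (tight_sets \<B> z)"
      using y(2) B(2) by (intro least[OF z(1)]) blast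
    ultimately show False using B(1) card_Diff1_less[of "tight_sets \<B> y" B] by simp
  qed
  then show thesis using that y by blast
qed

text \<open>Equal fans force each tight family to coincide with a nested set spanning the same cone.
  Conversely, if tight families are nested, every nested set is realised, so both fans range over
  the same families.\<close>

lemma nested_fan_eq_normal_fan_iff:
  "nested_fan \<B> = normal_fan P \<longleftrightarrow> (\<forall>x\<in>P. nested_set \<B> (tight_sets \<B> x))"
proof
  assume eq: "nested_fan \<B> = normal_fan P"
  show "\<forall>x\<in>P. nested_set \<B> (tight_sets \<B> x)"
  proof
    fix x assume "x \<in> P"
    then have "convex_cone hull (proj_char ` tight_sets \<B> x) \<in> nested_fan \<B>"
      unfolding eq normal_fan_removahedron by blast
    then obtain T where "nested_set \<B> T"
      "convex_cone hull (proj_char ` tight_sets \<B> x) = convex_cone hull (proj_char ` T)"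
      unfolding nested_fan_def by blast
    with nested_cone_eq_imp_eq[OF this(1) tight_sets_subset] show "nested_set \<B> (tight_sets \<B> x)" by metis
  qed
next
  assume all_nested: "\<forall>x\<in>P. nested_set \<B> (tight_sets \<B> x)"
  then have "{T. nested_set \<B> T} = tight_sets \<B> ` P"
    using ex_tight_sets_eq by blast
  then have "nested_fan \<B> = (\<lambda>T. convex_cone hull (proj_char ` T)) ` tight_sets \<B> ` P"
    unfolding nested_fan_def by blast
  then show "nested_fan \<B> = normal_fan P"
    by (simp add: normal_fan_removahedron image_image)
qed

section \<open>Chordful graphs\<close>

lemma removahedron_sum_ge:
  "x \<in> P \<Longrightarrow> B \<in> \<B> \<Longrightarrow> real (card B) * (real (card B) + 1) / 2 \<le> (\<Sum>s\<in>B. x $ s)"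
  by (simp add: mem_removahedron_iff flip: real_Suc_choose_2)

lemma tight_sets_sum:
  "B \<in> tight_sets \<B> x \<Longrightarrow> (\<Sum>s\<in>B. x $ s) = real (card B) * (real (card B) + 1) / 2"
  by (simp add: tight_sets_def flip: real_Suc_choose_2)

text \<open>
  The right-hand sides are supermodular with defect \<open>|A - B| |B - A|\<close>; this is the product
  \<open>(u - a) (u - b)\<close> in the proof.
\<close>

lemma tight_sets_nested_if_union:
  assumes x: "x \<in> P" and AB: "A \<in> tight_sets \<B> x" "B \<in> tight_sets \<B> x"
    and union: "A \<union> B \<in> \<B>" and inter: "A \<inter> B = {} \<or> A \<inter> B \<in> \<B>"
  shows "A \<subseteq> B \<or> B \<subseteq> A"
proof -
  define a b u i where "a = real (card A)" "b = real (card B)" "u = real (card (A \<union> B))" "i = real (card (A \<inter> B))"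
  note defs = this
  have ui: "i = a + b - u"
    using card_Un_Int[of A B] unfolding defs by simp
  have "u * (u + 1) / 2 + i * (i + 1) / 2 \<le> (\<Sum>s\<in>A \<union> B. x $ s) + (\<Sum>s\<in>A \<inter> B. x $ s)"
  proof (rule add_mono)
    show "u * (u + 1) / 2 \<le> (\<Sum>s\<in>A \<union> B. x $ s)"
      unfolding defs by (rule removahedron_sum_ge[OF x union])
    \<comment> \<open>For disjoint sets both sides are 0; otherwise the intersection is itself a
      member and its inequality applies.\<close>
    show "i * (i + 1) / 2 \<le> (\<Sum>s\<in>A \<inter> B. x $ s)"
      unfolding defs using inter removahedron_sum_ge[OF x, of "A \<inter> B"] by auto
  qed
  also have "\<dots> = a * (a + 1) / 2 + b * (b + 1) / 2"
    unfolding defs by (simp add: sum.union_inter tight_sets_sum[OF AB(1)] tight_sets_sum[OF AB(2)])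
  finally have "(u - a) * (u - b) \<le> 0"
    unfolding ui by (simp add: field_simps)
  moreover have "a \<le> u" "b \<le> u" unfolding defs by (simp_all add: card_mono)
  ultimately have "u = a \<or> u = b" by (simp add: mult_le_0_iff) linarith
  then show ?thesis
    unfolding defs using card_subset_eq[of "A \<union> B" A] card_subset_eq[of "A \<union> B" B] by auto
qed

text \<open>Sets that meet have a connected union, and disjoint sets violating the pair condition
  have one by assumption. In both cases supermodularity makes them comparable.\<close>

lemma tight_sets_nested:
  assumes inter: "\<And>A B. A \<in> \<B> \<Longrightarrow> B \<in> \<B> \<Longrightarrow> A \<inter> B \<noteq> {} \<Longrightarrow> A \<inter> B \<in> \<B>" and x: "x \<in> P"
  shows "nested_set \<B> (tight_sets \<B> x)"
  unfolding nested_set_\<B>_iff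
proof (intro conjI ballI)
  show "tight_sets \<B> x \<subseteq> \<B> - {UNIV}" by (rule tight_sets_subset)
  fix A B assume AB: "A \<in> tight_sets \<B> x" "B \<in> tight_sets \<B> x"
  then have "A \<in> \<B>" "B \<in> \<B>" using tight_sets_subset by blast+
  then have "A \<inter> B = {} \<or> A \<inter> B \<in> \<B>" "A \<inter> B \<noteq> {} \<Longrightarrow> A \<union> B \<in> \<B>"
    using inter \<B>_Un_meet by blast+
  then show "A \<subseteq> B \<or> B \<subseteq> A \<or> A \<inter> B = {} \<and> A \<union> B \<notin> \<B>"
    using tight_sets_nested_if_union[OF x AB] by blast
qed

section \<open>Intersections in chordful graphs\<close>

text \<open>Suppose that no arc joins the two sides of a cut of the intersection. A path in
  \<open>A\<close> and a path in \<open>B\<close> between the sides give a cycle through a vertex of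
  each side, and its chord crosses the cut.\<close>

lemma chordful_inter_mem_\<B>:
  assumes chordful: "chordful G" and A: "A \<in> \<B>" and B: "B \<in> \<B>" and meet: "A \<inter> B \<noteq> {}"
  shows "A \<inter> B \<in> \<B>"
proof (rule \<B>_cutI[OF meet], rule ccontr)
  fix X assume X: "X \<subseteq> A \<inter> B" "X \<noteq> {}" "X \<noteq> A \<inter> B"
    and no_arc: "\<not> (\<exists>u\<in>X. \<exists>v\<in>A \<inter> B - X. u \<sim> v)"
  define Y where "Y = A \<inter> B - X"
  have XY: "A \<inter> B = X \<union> Y" "X \<inter> Y = {}" "Y \<noteq> {}" using X by (auto simp: Y_def)
  have no_arc: "\<not> u \<sim> v" if "u \<in> X" "v \<in> Y" for u v using no_arc that by (auto simp: Y_def)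
  define paths where "paths xs ys \<longleftrightarrow> (\<exists>a\<in>X. \<exists>c\<in>Y. path_in A a c xs \<and> path_in B a c ys)" for xs ys
  \<comment> \<open>A pair of paths of least total length is internally disjoint, so it closes up to a cycle.\<close>
  obtain a0 c0 where ac0: "a0 \<in> X" "c0 \<in> Y" using X XY by blast
  then have "a0 \<in> A" "a0 \<in> B" "c0 \<in> A" "c0 \<in> B" using XY(1) by blast+
  then obtain xs0 ys0 where "path_in A a0 c0 xs0" "path_in B a0 c0 ys0"
    using \<B>_path[OF A] \<B>_path[OF B] by metis
  then have "paths (fst (xs0, ys0)) (snd (xs0, ys0))" using ac0 by (auto simp: paths_def)
  from ex_has_least_nat[of "\<lambda>(xs, ys). paths xs ys", of "(xs0, ys0)" "\<lambda>(xs, ys). length xs + length ys"] this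
  obtain xs ys where xs_ys: "paths xs ys"
    and least: "\<And>xs' ys'. paths xs' ys' \<Longrightarrow> length xs + length ys \<le> length xs' + length ys'"
    by (auto simp: case_prod_beta)
  obtain a c where ac: "a \<in> X" "c \<in> Y" and xs: "path_in A a c xs" and ys: "path_in B a c ys"
    using xs_ys by (auto simp: paths_def)
  have "a \<noteq> c" using ac XY(2) by blast
  have dist_xs: "distinct xs"
  proof (rule ccontr)
    assume "\<not> distinct xs"
    then obtain p w q r where eq: "xs = p @ [w] @ q @ [w] @ r" using not_distinct_decomp by blast
    have "path_in A a c (p @ w # r)" by (rule path_in_shortcut[OF xs[unfolded eq]])
    then have "paths (p @ w # r) ys" unfolding paths_def using ac ys by blast
    from least[OF this] show False by (simp add: eq)
  qed
  have dist_ys: "distinct ys"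
  proof (rule ccontr)
    assume "\<not> distinct ys"
    then obtain p w q r where eq: "ys = p @ [w] @ q @ [w] @ r" using not_distinct_decomp by blast
    have "path_in B a c (p @ w # r)" by (rule path_in_shortcut[OF ys[unfolded eq]])
    then have "paths xs (p @ w # r)" unfolding paths_def using ac xs by blast
    from least[OF this] show False by (simp add: eq)
  qed
  \<comment> \<open>A common inner vertex lies in \<open>A \<inter> B\<close>, hence on one side of
    the cut. It can replace the end of both paths on that side, which shortens them.\<close>
  have common: "w = a \<or> w = c" if w: "w \<in> set xs" "w \<in> set ys" for w
  proof (rule ccontr)
    assume neq: "\<not> (w = a \<or> w = c)"
    obtain p q where eq: "xs = p @ w # q" using split_list[OF w(1)] by blast
    obtain p' q' where eq': "ys = p' @ w # q'" using split_list[OF w(2)] by blast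
    have "w \<in> A \<inter> B" using w xs ys unfolding path_in_def by blast
    then consider "w \<in> X" | "w \<in> Y" using XY(1) by blast
    then show False
    proof cases
      case 1
      then have "paths (w # q) (w # q')"
        unfolding paths_def using ac path_in_split(2)[OF xs[unfolded eq]] path_in_split(2)[OF ys[unfolded eq']] by blast
      moreover have "p \<noteq> []" using xs neq by (auto simp: eq path_in_def)
      ultimately show False using least[of "w # q" "w # q'"] by (simp add: eq eq')
    next
      case 2
      then have "paths (p @ [w]) (p' @ [w])"
        unfolding paths_def using ac path_in_split(1)[OF xs[unfolded eq]] path_in_split(1)[OF ys[unfolded eq']] by blast
      moreover have "q \<noteq> []" using xs neq by (auto simp: eq path_in_def)
      ultimately show False using least[of "p @ [w]" "p' @ [w]"] by (simp add: eq eq')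
    qed
  qed
  obtain l where l: "xs = a # l @ [c]" using xs \<open>a \<noteq> c\<close> path_in_ends by blast
  obtain l' where l': "ys = a # l' @ [c]" using ys \<open>a \<noteq> c\<close> path_in_ends by blast
  \<comment> \<open>The cycle runs along \<open>xs\<close> and returns through the interior of
    \<open>ys\<close>. Its length is at least 3 because the ends of \<open>xs\<close> are not
    adjacent.\<close>
  define zs where "zs = xs @ rev l'"
  have dist: "distinct zs" using dist_xs dist_ys common by (auto simp: zs_def l l')
  have "l \<noteq> []" using xs no_arc[OF ac] by (auto simp: l path_in_def)
  then have len: "3 \<le> length zs" by (cases l) (auto simp: zs_def l)
  have "successively (\<sim>) (zs @ [a])"
  proof -
    have "successively (\<sim>) (rev ys)"
      unfolding successively_rev using ys dominates_sym by (auto simp: path_in_def elim: successively_mono)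
    then have "successively (\<sim>) (c # (rev l' @ [a]))" by (simp add: l')
    then have "successively (\<sim>) (rev l' @ [a])" "c \<sim> hd (rev l' @ [a])" by (auto simp: successively_Cons)
    moreover have "successively (\<sim>) xs" "last xs = c" using xs by (auto simp: path_in_def)
    ultimately show ?thesis by (simp add: zs_def successively_append_iff[of _ xs])
  qed
  moreover have "zs \<noteq> []" "hd zs = a" by (simp_all add: zs_def l)
  ultimately have "successively (\<sim>) zs" "last zs \<sim> hd zs"
    by (simp_all add: successively_append_iff[of _ zs "[a]"])
  moreover have "a \<in> set zs" "c \<in> set zs" by (simp_all add: zs_def l)
  ultimately have "a \<sim> c"
    using chordful[unfolded chordful_iff, rule_format, of zs a c] dist len \<open>a \<noteq> c\<close> by blast
  then show False using no_arc[OF ac] by simp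
qed

section \<open>An unrealisable nested set in a non-chordful graph\<close>

text \<open>The path must leave \<open>X\<close>, and the exit vertex avoids \<open>Y\<close>
  because no arc joins \<open>X\<close> to \<open>Y\<close>. It can be added to \<open>X\<close>, so
  maximality makes the enlarged union connected. Locating it on the path later keeps two such
  vertices apart.\<close>

lemma connecting_vertex:
  assumes X: "X \<in> \<B>" and Y: "Y \<in> \<B>" and XY: "X \<union> Y \<notin> \<B>"
    and maximal: "\<And>u. u \<notin> X \<union> Y \<Longrightarrow> X \<union> {u} \<in> \<B> \<Longrightarrow> X \<union> {u} \<union> Y \<in> \<B>"
    and path: "path_in R a c zs" and ac: "a \<in> X" "c \<in> Y"
  obtains u where "u \<in> set zs" "u \<notin> X" "u \<notin> Y" "X \<union> Y \<union> {u} \<in> \<B>"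
proof -
  have "c \<notin> X" using \<B>_Un_meet[OF X Y] XY ac(2) by blast
  then obtain w u where wu: "w \<in> X" "u \<in> set zs" "u \<notin> X" "w \<sim> u"
    using path_exit[of zs X] path ac by (auto simp: path_in_def)
  have "u \<notin> Y" using \<B>_Un_adjacent[OF X Y wu(1) _ wu(4)] XY by blast
  moreover have "X \<union> {u} \<in> \<B>" using \<B>_Un_adjacent[OF X singleton_mem_\<B> wu(1) _ wu(4)] by simp
  ultimately have "X \<union> {u} \<union> Y \<in> \<B>" using maximal wu(3) by blast
  then have "X \<union> Y \<union> {u} \<in> \<B>" by (simp add: Un_ac)
  then show thesis using that wu \<open>u \<notin> Y\<close> by blast
qed

lemma nested_set_not_tight:
  assumes X: "X \<in> \<B>" and Y: "Y \<in> \<B>" and disj: "X \<inter> Y = {}" and XY: "X \<union> Y \<notin> \<B>"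
    and u: "u \<notin> X \<union> Y" "X \<union> Y \<union> {u} \<in> \<B>" and v: "v \<notin> X \<union> Y" "X \<union> Y \<union> {v} \<in> \<B>" and "u \<noteq> v"
  obtains T where "nested_set \<B> T" "\<And>x. x \<in> P \<Longrightarrow> tight_sets \<B> x \<noteq> T"
proof -
  define A B C where "A = X \<union> Y \<union> {u}" "B = X \<union> Y \<union> {v}" "C = X \<union> Y \<union> {u, v}"
  note defs = this
  \<comment> \<open>\<open>C\<close> may be the whole vertex set, which no nested set contains; its
    equation then holds at every point of the removahedron.\<close>
  define T where "T = {X, Y, A, C} - {UNIV}"
  have "X \<noteq> {}" "Y \<noteq> {}" using X Y \<B>_nonempty by blast+
  have "C = A \<union> B" by (auto simp: defs)
  moreover have "A \<inter> B \<noteq> {}" using \<open>X \<noteq> {}\<close> by (auto simp: defs)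
  ultimately have "C \<in> \<B>" using \<B>_Un_meet[of A B] u v by (simp add: defs)
  have neq_UNIV: "X \<noteq> UNIV" "Y \<noteq> UNIV" "A \<noteq> UNIV" "B \<noteq> UNIV"
    using u(1) v(1) \<open>u \<noteq> v\<close> by (auto simp: defs)
  have "nested_set \<B> ({X, Y, A, C} - {UNIV})"
  proof -
    have "X \<subseteq> A" "Y \<subseteq> A" "A \<subseteq> C" "X \<subseteq> C" "Y \<subseteq> C" by (auto simp: defs)
    moreover have "{X, Y, A, C} \<subseteq> \<B>" using X Y u(2) \<open>C \<in> \<B>\<close> by (simp add: defs)
    moreover have "Y \<inter> X = {}" "Y \<union> X \<notin> \<B>" using disj XY by (simp_all add: Un_commute Int_commute)
    ultimately show ?thesis
      unfolding nested_set_\<B>_iff using disj XY by auto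
  qed
  then have "nested_set \<B> T" by (simp add: T_def)
  moreover have "tight_sets \<B> x \<noteq> T" if x: "x \<in> P" for x
  proof
    assume tight: "tight_sets \<B> x = T"
    let ?t = "\<lambda>n::real. n * (n + 1) / 2"
    define p q where "p = real (card X)" "q = real (card Y)"
    have pq: "1 \<le> p" "1 \<le> q"
      using \<open>X \<noteq> {}\<close> \<open>Y \<noteq> {}\<close> by (auto simp: p_q_def Suc_le_eq card_gt_0_iff)
    have card: "real (card A) = p + q + 1" "real (card B) = p + q + 1" "real (card C) = p + q + 2"
      using u(1) v(1) \<open>u \<noteq> v\<close> disj by (simp_all add: defs p_q_def card_Un_disjoint)
    have sum_t: "(\<Sum>s\<in>N. x $ s) = ?t (real (card N))" if "N \<in> {X, Y, A, C}" for N
    proof (cases "N = UNIV")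
      case True
      then show ?thesis using x by (simp add: mem_removahedron_iff flip: real_Suc_choose_2)
    next
      case False
      then show ?thesis using tight_sets_sum[of N x] that by (simp add: tight T_def)
    qed
    have "(\<Sum>s\<in>X. x $ s) = ?t p" "(\<Sum>s\<in>Y. x $ s) = ?t q"
      "(\<Sum>s\<in>A. x $ s) = ?t (p + q + 1)" "(\<Sum>s\<in>C. x $ s) = ?t (p + q + 2)"
      using sum_t[of X] sum_t[of Y] sum_t[of A] sum_t[of C] by (simp_all add: card p_q_def)
    moreover have "(\<Sum>s\<in>C. x $ s) = (\<Sum>s\<in>A. x $ s) + x $ v"
      using u(1) v(1) \<open>u \<noteq> v\<close> by (simp add: defs)
    moreover have "(\<Sum>s\<in>B. x $ s) = (\<Sum>s\<in>X. x $ s) + (\<Sum>s\<in>Y. x $ s) + x $ v"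
      using v(1) disj by (simp add: defs sum.union_disjoint)
    ultimately have "(\<Sum>s\<in>B. x $ s) = ?t p + ?t q + ?t (p + q + 2) - ?t (p + q + 1)" by linarith
    also have "\<dots> = ?t (p + q + 1) + (1 - p * q)" by (simp add: field_simps)
    finally have sum_B: "(\<Sum>s\<in>B. x $ s) = ?t (p + q + 1) + (1 - p * q)" .
    have "B \<in> \<B>" using v(2) by (simp add: defs)
    have "?t (p + q + 1) \<le> (\<Sum>s\<in>B. x $ s)"
      using removahedron_sum_ge[OF x \<open>B \<in> \<B>\<close>] by (simp add: card)
    \<comment> \<open>The slack \<open>1 - p * q\<close> is thus at most 0, and feasibility makes it
      at least 0.\<close>
    moreover have "1 \<le> p * q" using mult_mono[of 1 p 1 q] pq by simp
    ultimately have "(\<Sum>s\<in>B. x $ s) = ?t (real (card B))" using sum_B card(2) by simp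
    then have "B \<in> tight_sets \<B> x"
      using \<open>B \<in> \<B>\<close> neq_UNIV by (simp add: tight_sets_def real_Suc_choose_2)
    \<comment> \<open>Membership of \<open>v\<close> separates \<open>B\<close> from
      \<open>X\<close>, \<open>Y\<close> and \<open>A\<close>, and membership of \<open>u\<close>
      separates it from \<open>C\<close>.\<close>
    then have "B \<in> {X, Y, A, C}" by (simp add: tight T_def)
    moreover have "v \<in> B" "v \<notin> X" "v \<notin> Y" "v \<notin> A" "u \<in> C" "u \<notin> B"
      using u(1) v(1) \<open>u \<noteq> v\<close> by (auto simp: defs)
    ultimately show False by blast
  qed
  ultimately show thesis by (rule that)
qed

text \<open>Two non-adjacent vertices of a cycle start a pair of connected sets with disconnected
  union. Once this pair is maximal, each of the two arcs of the cycle between them supplies one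
  connecting vertex.\<close>

lemma not_chordful_nested_set_not_tight:
  assumes "\<not> chordful G"
  obtains T where "nested_set \<B> T" "\<And>x. x \<in> P \<Longrightarrow> tight_sets \<B> x \<noteq> T"
proof -
  obtain xs a' c' where cycle: "distinct xs" "successively (\<sim>) xs" "last xs \<sim> hd xs"
    and ac': "a' \<in> set xs" "c' \<in> set xs" "a' \<noteq> c'" "\<not> a' \<sim> c'"
    using assms unfolding chordful_iff by blast
  \<comment> \<open>The order of the two vertices along the list is unknown, so only the unordered
    pair is kept.\<close>
  obtain a c l1 l2 l3 where xs: "xs = l1 @ a # l2 @ c # l3" and "{a, c} = {a', c'}"
  proof -
    obtain r s where rs: "xs = r @ a' # s" using ac'(1) by (metis split_list)
    consider "c' \<in> set r" | "c' \<in> set s" using rs ac' by auto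
    then show thesis
    proof cases
      case 1
      then obtain r1 r2 where "r = r1 @ c' # r2" by (metis split_list)
      then show thesis using that[of r1 c' r2 a' s] rs by auto
    next
      case 2
      then obtain s1 s2 where "s = s1 @ c' # s2" by (metis split_list)
      then show thesis using that[of r a' s1 c' s2] rs by auto
    qed
  qed
  then have ac: "a \<noteq> c" "\<not> a \<sim> c" "\<not> c \<sim> a"
    using ac' dominates_sym by (auto simp: doubleton_eq_iff)
  have path1: "path_in UNIV a c (a # l2 @ [c])"
  proof -
    have "path_in UNIV (hd xs) (last xs) xs" using cycle(2) by (simp add: path_in_def xs)
    then have "path_in UNIV a (last xs) ((a # l2) @ c # l3)"
      using path_in_split(2)[of UNIV "hd xs" "last xs" l1 a "l2 @ c # l3"] by (simp add: xs)
    from path_in_split(1)[OF this] show ?thesis by simp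
  qed
  have path2: "path_in UNIV c a (c # l3 @ l1 @ [a])"
  proof -
    have "successively (\<sim>) (l1 @ [a])" "successively (\<sim>) (c # l3)"
      using cycle(2) by (auto simp: xs successively_append_iff successively_Cons)
    moreover have "last (c # l3) \<sim> hd (l1 @ [a])"
      using cycle(3) by (cases l1) (auto simp: xs)
    ultimately have "successively (\<sim>) ((c # l3) @ (l1 @ [a]))"
      by (simp only: successively_append_iff) simp
    then show ?thesis by (simp add: path_in_def)
  qed
  define sep where "sep XY \<longleftrightarrow> fst XY \<in> \<B> \<and> snd XY \<in> \<B> \<and> a \<in> fst XY \<and> c \<in> snd XY \<and> fst XY \<union> snd XY \<notin> \<B>" for XY
  have "{a} \<union> {c} \<notin> \<B>"
  proof
    assume "{a} \<union> {c} \<in> \<B>"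
    then obtain z w where "z \<in> {a} \<union> {c}" "z \<in> {a}" "w \<in> {a} \<union> {c}" "w \<notin> {a}" "z \<sim> w"
      by (rule \<B>_cut[of _ "{a}"]) (use ac in auto)
    then show False using ac by auto
  qed
  then have "sep ({a}, {c})" by (simp add: sep_def singleton_mem_\<B>)
  \<comment> \<open>A complement of least size means that neither set can be enlarged by an outside
    vertex while both remain connected and separated.\<close>
  from ex_has_least_nat[of sep, OF this, of "\<lambda>XY. card (- (fst XY \<union> snd XY))"]
  obtain X Y where sep: "sep (X, Y)"
    and least: "\<And>X' Y'. sep (X', Y') \<Longrightarrow> card (- (X \<union> Y)) \<le> card (- (X' \<union> Y'))"
    by auto
  have XY: "X \<in> \<B>" "Y \<in> \<B>" "a \<in> X" "c \<in> Y" "X \<union> Y \<notin> \<B>" using sep by (simp_all add: sep_def)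
  have disj: "X \<inter> Y = {}" using \<B>_Un_meet[OF XY(1,2)] XY(5) by blast
  have card_less: "card (- (insert u (X \<union> Y))) < card (- (X \<union> Y))" if "u \<notin> X \<union> Y" for u
    using that by (intro psubset_card_mono) auto
  have "X \<union> {u} \<union> Y \<in> \<B>" if u: "u \<notin> X \<union> Y" "X \<union> {u} \<in> \<B>" for u
  proof (rule ccontr)
    assume "X \<union> {u} \<union> Y \<notin> \<B>"
    then have "sep (X \<union> {u}, Y)" using XY u by (simp add: sep_def)
    then show False using least card_less[OF u(1)] by fastforce
  qed
  then obtain u where u: "u \<in> set (a # l2 @ [c])" "u \<notin> X" "u \<notin> Y" "X \<union> Y \<union> {u} \<in> \<B>"
    using connecting_vertex[OF XY(1,2,5) _ path1 XY(3,4)] by metis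
  have "Y \<union> {v} \<union> X \<in> \<B>" if v: "v \<notin> Y \<union> X" "Y \<union> {v} \<in> \<B>" for v
  proof (rule ccontr)
    assume "Y \<union> {v} \<union> X \<notin> \<B>"
    then have "sep (X, Y \<union> {v})" using XY v by (simp add: sep_def Un_commute)
    then show False using least card_less[of v] v(1) by fastforce
  qed
  \<comment> \<open>The second arc runs from \<open>c\<close> back to \<open>a\<close>, so
    \<open>X\<close> and \<open>Y\<close> exchange roles.\<close>
  then obtain v where v: "v \<in> set (c # l3 @ l1 @ [a])" "v \<notin> Y" "v \<notin> X" "Y \<union> X \<union> {v} \<in> \<B>"
    using connecting_vertex[OF XY(2,1) _ _ path2 XY(4,3)] XY(5) by (metis Un_commute)
  \<comment> \<open>The ends \<open>a\<close> and \<open>c\<close> lie in \<open>X\<close> and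
    \<open>Y\<close>, so \<open>u\<close> and \<open>v\<close> are interior to arcs with no common
    interior vertex.\<close>
  have "u \<in> set l2" "v \<in> set l3 \<union> set l1" using u v XY(3,4) by auto
  then have "u \<noteq> v" using cycle(1) by (auto simp: xs)
  show thesis
    by (rule nested_set_not_tight[OF XY(1,2) disj XY(5), of u v])
      (use u v \<open>u \<noteq> v\<close> that in \<open>auto simp: Un_commute\<close>)
qed

end

theorem theorem2p16:
  fixes G :: "('v::finite, 'a) pre_digraph"
  assumes "graph G"
    and "verts G = UNIV"
    and "Digraph_Component.connected G"
  shows "nested_fan (graphical_building_set G) =
           normal_fan (removahedron (graphical_building_set G)) \<longleftrightarrow>
         chordful G"
proof -
  interpret connected_graph_on G
    using assms by (intro connected_graph_on.intro connected_graph_on_axioms.intro)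
  show ?thesis
    unfolding nested_fan_eq_normal_fan_iff
  proof
    assume "\<forall>x\<in>P. nested_set \<B> (tight_sets \<B> x)"
    then show "chordful G"
      using ex_tight_sets_eq not_chordful_nested_set_not_tight by metis
  next
    assume "chordful G"
    then show "\<forall>x\<in>P. nested_set \<B> (tight_sets \<B> x)"
      using chordful_inter_mem_\<B> tight_sets_nested by blast
  qed
qed

end
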